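(* The top normalisation relation $\Longrightarrow$ on types is terminating and confluent.
   Context: Types: $\sigma ::= \varphi \mid \omega \mid \sigma\to\sigma \mid \sigma\wedge\sigma \mid \sigma\vee\sigma$, $\varphi$ ranging over a denumerable set of atomic types, $\omega$ a further constant. Types are considered modulo associativity, commutativity and idempotence of $\wedge$ and $\vee$. The normalisation preorder $\le$ is the least preorder with $\sigma\le\omega$, $\sigma\wedge\tau\le\sigma$, $\sigma\wedge\tau\le\tau$, $\sigma\le\sigma\vee\tau$, $\tau\le\sigma\vee\tau$, ($\sigma\le\tau,\sigma\le\rho\Rightarrow\sigma\le\tau\wedge\rho$), ($\sigma\le\tau,\rho\le\tau\Rightarrow\sigma\vee\rho\le\tau$), $\varphi\le\sigma\to\varphi$, $\omega\le\sigma\to\omega$, ($\sigma'\le\sigma,\tau\le\tau'\Rightarrow\sigma\to\tau\le\sigma'\to\tau'$). The inner normalisation relation $\rightsquigarrow$ consists exactly of: $\omega\to\varphi\rightsquigarrow\varphi$; $\sigma\rightsquigarrow\omega$ whenever $\omega\le\sigma$ and $\sigma\ne\omega$; $\sigma\to\tau\wedge\rho\rightsquigarrow(\sigma\to\tau)\wedge(\sigma\to\rho)$; $(\sigma\vee\tau)\wedge\rho\to\zeta\rightsquigarrow(\sigma\wedge\rho)\vee(\tau\wedge\rho)\to\zeta$; $\sigma\vee\tau\to\rho\rightsquigarrow(\sigma\to\rho)\wedge(\tau\to\rho)$; $\sigma\to(\tau\wedge\rho)\vee\zeta\rightsquigarrow\sigma\to(\tau\vee\zeta)\wedge(\rho\vee\zeta)$;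 $\sigma\wedge\tau\rightsquigarrow\sigma$ and $\sigma\vee\tau\rightsquigarrow\tau$ whenever $\sigma\le\tau$. Type contexts: $C[\,]::=[\,]\mid C[\,]\to\sigma\mid\sigma\to C[\,]\mid\sigma\wedge C[\,]\mid C[\,]\wedge\sigma\mid\sigma\vee C[\,]\mid C[\,]\vee\sigma$. The top normalisation relation $\Longrightarrow$ consists of: $C[\sigma]\Longrightarrow C[\tau]$ whenever $\sigma\rightsquigarrow\tau$; and $(\sigma\wedge\tau)\vee\rho\Longrightarrow(\sigma\vee\rho)\wedge(\tau\vee\rho)$.
   Formalization: Steps are taken only on representatives without repeated members of ∧ or ∨ (otherwise σ=σ∧σ⇝σ loops), and top distributivity also applies to each member of the outermost intersection (otherwise (a∧b)∨(c∧d) has two distinct normal forms). *)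

theory Defs
  imports "HOL-Library.Confluence"
begin

datatype ty_expr =
    Atom nat
  | Omega  (\<open>\<omega>\<close>)
  | Arrow ty_expr ty_expr  (infixr \<open>\<rightarrow>\<close> 60)
  | Inter ty_expr ty_expr  (infixr \<open>\<^bold>\<and>\<close> 70)
  | Union ty_expr ty_expr  (infixr \<open>\<^bold>\<or>\<close> 65)

inductive aci :: "ty_expr \<Rightarrow> ty_expr \<Rightarrow> bool"  (infix \<open>\<approx>\<close> 50) where
  refl: "\<sigma> \<approx> \<sigma>"
| sym: "\<sigma> \<approx> \<tau> \<Longrightarrow> \<tau> \<approx> \<sigma>"
| trans: "\<sigma> \<approx> \<tau> \<Longrightarrow> \<tau> \<approx> \<rho> \<Longrightarrow> \<sigma> \<approx> \<rho>"
| cong_arrow: "\<sigma> \<approx> \<sigma>' \<Longrightarrow> \<tau> \<approx> \<tau>' \<Longrightarrow> (\<sigma> \<rightarrow> \<tau>) \<approx> (\<sigma>' \<rightarrow> \<tau>')"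
| cong_inter: "\<sigma> \<approx> \<sigma>' \<Longrightarrow> \<tau> \<approx> \<tau>' \<Longrightarrow> \<sigma> \<^bold>\<and> \<tau> \<approx> \<sigma>' \<^bold>\<and> \<tau>'"
| cong_union: "\<sigma> \<approx> \<sigma>' \<Longrightarrow> \<tau> \<approx> \<tau>' \<Longrightarrow> \<sigma> \<^bold>\<or> \<tau> \<approx> \<sigma>' \<^bold>\<or> \<tau>'"
| assoc_inter: "(\<sigma> \<^bold>\<and> \<tau>) \<^bold>\<and> \<rho> \<approx> \<sigma> \<^bold>\<and> (\<tau> \<^bold>\<and> \<rho>)"
| assoc_union: "(\<sigma> \<^bold>\<or> \<tau>) \<^bold>\<or> \<rho> \<approx> \<sigma> \<^bold>\<or> (\<tau> \<^bold>\<or> \<rho>)"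
| comm_inter: "\<sigma> \<^bold>\<and> \<tau> \<approx> \<tau> \<^bold>\<and> \<sigma>"
| comm_union: "\<sigma> \<^bold>\<or> \<tau> \<approx> \<tau> \<^bold>\<or> \<sigma>"
| idem_inter: "\<sigma> \<^bold>\<and> \<sigma> \<approx> \<sigma>"
| idem_union: "\<sigma> \<^bold>\<or> \<sigma> \<approx> \<sigma>"

lemma equivp_aci: "equivp (\<approx>)"
  by (intro equivpI reflpI sympI transpI) (blast intro: aci.intros)+

quotient_type ty = ty_expr / "(\<approx>)"
  by (rule equivp_aci)

inductive norm_le :: "ty_expr \<Rightarrow> ty_expr \<Rightarrow> bool"  (infix \<open>\<preceq>\<close> 50) where
  le_refl: "\<sigma> \<preceq> \<sigma>"
| le_trans: "\<sigma> \<preceq> \<tau> \<Longrightarrow> \<tau> \<preceq> \<rho> \<Longrightarrow> \<sigma> \<preceq> \<rho>"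
| le_omega: "\<sigma> \<preceq> \<omega>"
| inter_le1: "\<sigma> \<^bold>\<and> \<tau> \<preceq> \<sigma>"
| inter_le2: "\<sigma> \<^bold>\<and> \<tau> \<preceq> \<tau>"
| le_union1: "\<sigma> \<preceq> \<sigma> \<^bold>\<or> \<tau>"
| le_union2: "\<tau> \<preceq> \<sigma> \<^bold>\<or> \<tau>"
| le_inter: "\<sigma> \<preceq> \<tau> \<Longrightarrow> \<sigma> \<preceq> \<rho> \<Longrightarrow> \<sigma> \<preceq> \<tau> \<^bold>\<and> \<rho>"
| union_le: "\<sigma> \<preceq> \<tau> \<Longrightarrow> \<rho> \<preceq> \<tau> \<Longrightarrow> \<sigma> \<^bold>\<or> \<rho> \<preceq> \<tau>"
| atom_le: "Atom n \<preceq> (\<sigma> \<rightarrow> Atom n)"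
| omega_le: "\<omega> \<preceq> (\<sigma> \<rightarrow> \<omega>)"
| arrow_mono: "\<sigma>' \<preceq> \<sigma> \<Longrightarrow> \<tau> \<preceq> \<tau>' \<Longrightarrow> (\<sigma> \<rightarrow> \<tau>) \<preceq> (\<sigma>' \<rightarrow> \<tau>')"

text \<open>The preorder on expressions already identifies \<open>\<approx>\<close>-equal ones, so it is
  the preorder on types.\<close>

lemma aci_imp_le: "\<sigma> \<approx> \<tau> \<Longrightarrow> \<sigma> \<preceq> \<tau> \<and> \<tau> \<preceq> \<sigma>"
  by (induction rule: aci.induct) (blast intro: norm_le.intros)+

inductive inner_step :: "ty_expr \<Rightarrow> ty_expr \<Rightarrow> bool"  (infix \<open>\<leadsto>\<close> 50) where
  omega_arrow: "(\<omega> \<rightarrow> Atom n) \<leadsto> Atom n"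
| to_omega: "\<omega> \<preceq> \<sigma> \<Longrightarrow> \<not> \<sigma> \<approx> \<omega> \<Longrightarrow> \<sigma> \<leadsto> \<omega>"
| arrow_inter: "(\<sigma> \<rightarrow> \<tau> \<^bold>\<and> \<rho>) \<leadsto> (\<sigma> \<rightarrow> \<tau>) \<^bold>\<and> (\<sigma> \<rightarrow> \<rho>)"
| distr_left: "((\<sigma> \<^bold>\<or> \<tau>) \<^bold>\<and> \<rho> \<rightarrow> \<zeta>) \<leadsto> ((\<sigma> \<^bold>\<and> \<rho>) \<^bold>\<or> (\<tau> \<^bold>\<and> \<rho>) \<rightarrow> \<zeta>)"
| union_arrow: "(\<sigma> \<^bold>\<or> \<tau> \<rightarrow> \<rho>) \<leadsto> (\<sigma> \<rightarrow> \<rho>) \<^bold>\<and> (\<tau> \<rightarrow> \<rho>)"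
| distr_right: "(\<sigma> \<rightarrow> (\<tau> \<^bold>\<and> \<rho>) \<^bold>\<or> \<zeta>) \<leadsto> (\<sigma> \<rightarrow> (\<tau> \<^bold>\<or> \<zeta>) \<^bold>\<and> (\<rho> \<^bold>\<or> \<zeta>))"
| erase_inter: "\<sigma> \<preceq> \<tau> \<Longrightarrow> \<sigma> \<^bold>\<and> \<tau> \<leadsto> \<sigma>"
| erase_union: "\<sigma> \<preceq> \<tau> \<Longrightarrow> \<sigma> \<^bold>\<or> \<tau> \<leadsto> \<tau>"

datatype ctxt =
    Hole
  | CArrow1 ctxt ty_expr
  | CArrow2 ty_expr ctxt
  | CInter1 ty_expr ctxt
  | CInter2 ctxt ty_expr
  | CUnion1 ty_expr ctxt
  | CUnion2 ctxt ty_expr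

primrec fill :: "ctxt \<Rightarrow> ty_expr \<Rightarrow> ty_expr" where
  "fill Hole \<tau> = \<tau>"
| "fill (CArrow1 C \<sigma>) \<tau> = (fill C \<tau> \<rightarrow> \<sigma>)"
| "fill (CArrow2 \<sigma> C) \<tau> = (\<sigma> \<rightarrow> fill C \<tau>)"
| "fill (CInter1 \<sigma> C) \<tau> = \<sigma> \<^bold>\<and> fill C \<tau>"
| "fill (CInter2 C \<sigma>) \<tau> = fill C \<tau> \<^bold>\<and> \<sigma>"
| "fill (CUnion1 \<sigma> C) \<tau> = \<sigma> \<^bold>\<or> fill C \<tau>"
| "fill (CUnion2 C \<sigma>) \<tau> = fill C \<tau> \<^bold>\<or> \<sigma>"

text \<open>The distributivity rule is a rule for the top level of a type, that is, for the
  members of its outermost intersection. Hence the rules \<open>inter1\<close> and \<open>inter2\<close>. Applied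
  to the whole type only, it would not be confluent: for distinct atoms,
  \<open>(a \<^bold>\<and> b) \<^bold>\<or> (c \<^bold>\<and> d)\<close> would reduce both to
  \<open>(a \<^bold>\<or> (c \<^bold>\<and> d)) \<^bold>\<and> (b \<^bold>\<or> (c \<^bold>\<and> d))\<close> and to
  \<open>(c \<^bold>\<or> (a \<^bold>\<and> b)) \<^bold>\<and> (d \<^bold>\<or> (a \<^bold>\<and> b))\<close>, to which no rule would apply.
  It is not a rule for arguments or results of arrows.\<close>

inductive top_step :: "ty_expr \<Rightarrow> ty_expr \<Rightarrow> bool" where
  inner: "\<sigma> \<leadsto> \<tau> \<Longrightarrow> top_step (fill C \<sigma>) (fill C \<tau>)"
| distr: "top_step ((\<sigma> \<^bold>\<and> \<tau>) \<^bold>\<or> \<rho>) ((\<sigma> \<^bold>\<or> \<rho>) \<^bold>\<and> (\<tau> \<^bold>\<or> \<rho>))"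
| inter1: "top_step \<sigma> \<sigma>' \<Longrightarrow> top_step (\<sigma> \<^bold>\<and> \<tau>) (\<sigma>' \<^bold>\<and> \<tau>)"
| inter2: "top_step \<tau> \<tau>' \<Longrightarrow> top_step (\<sigma> \<^bold>\<and> \<tau>) (\<sigma> \<^bold>\<and> \<tau>')"

text \<open>A step on types is taken on an expression without repeated members of an intersection
  or union; every rearrangement by associativity and commutativity is available. Since
  contracting a repetition makes an expression smaller, these expressions are the smallest
  ones in their class. Taken on arbitrary representatives, steps would not
  terminate: \<open>\<sigma> \<approx> \<sigma> \<^bold>\<and> \<sigma> \<leadsto> \<sigma>\<close>; and discarding steps between equal types does not help,
  since for \<open>A = (\<sigma> \<rightarrow> \<tau> \<^bold>\<and> \<rho>)\<close> and \<open>B = (\<sigma> \<rightarrow> \<tau>) \<^bold>\<and> (\<sigma> \<rightarrow> \<rho>)\<close> one has \<open>A \<approx> A \<^bold>\<and> A\<close>, which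
  reduces to \<open>A \<^bold>\<and> B\<close>, and this to \<open>A\<close> because \<open>A \<preceq> B\<close>.\<close>

definition irredundant :: "ty_expr \<Rightarrow> bool" where
  "irredundant \<sigma> \<longleftrightarrow> (\<forall>\<tau>. \<sigma> \<approx> \<tau> \<longrightarrow> size \<sigma> \<le> size \<tau>)"

definition top_red :: "ty \<Rightarrow> ty \<Rightarrow> bool"  (infix \<open>\<Longrightarrow>\<^sub>t\<close> 50) where
  "X \<Longrightarrow>\<^sub>t Y \<longleftrightarrow>
    (\<exists>\<sigma> \<tau>. X = abs_ty \<sigma> \<and> Y = abs_ty \<tau> \<and> irredundant \<sigma> \<and> top_step \<sigma> \<tau>)"

definition terminating :: "('a \<Rightarrow> 'a \<Rightarrow> bool) \<Rightarrow> bool" where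
  "terminating r \<longleftrightarrow> (\<nexists>f :: nat \<Rightarrow> 'a. \<forall>i. r (f i) (f (Suc i)))"

end

theory Submission
  imports Defs "HOL-Library.FSet"
begin

text \<open>Termination. A type is weighed twice, by \<open>weight True\<close> for a position that is brought into
  conjunctive normal form (the whole type and results of arrows) and by \<open>weight False\<close> for one
  brought into disjunctive normal form (arguments of arrows). One of the two lattice operations is
  interpreted by \<open>x + y + 1\<close>, the other by \<open>x * y\<close>, so the distributivity allowed in the position
  decreases the weight there; an arrow only looks at the \<open>False\<close> weight of its argument and the
  \<open>True\<close> weight of its result. Contracting a repetition also decreases weights, hence irredundant
  expressions are the lightest in their class and the weight of a type drops in every step.

  Confluence. Types are interpreted as sets of clauses and, dually, of cubes, whose elements are
  atoms and arrows from cubes to clauses. Every inner rule preserves both readings up to the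
  equivalence of a preorder that contains the normalisation preorder; the top distributivity
  preserves the clauses. The clauses of an irreducible type form an antichain of antichains from
  which the type can be read back, so two irreducible types reached from the same type coincide.\<close>

subsection \<open>Interpretation by normal forms\<close>

text \<open>\<open>Ar A B\<close> is the arrow from the intersection of \<open>A\<close> (empty for \<open>\<omega>\<close>) to the union of \<open>B\<close>.\<close>

datatype el = At nat | Ar "el list" "el list"

text \<open>The clause for an atom below an arrow iterates the axiom \<open>atom_le\<close>. No
  arrow lies below an atom, because the arrows to be identified with an atom are collapsed by
  \<open>arr\<close>.\<close>

function el_le :: "el \<Rightarrow> el \<Rightarrow> bool" where
  "el_le (At m) (At n) \<longleftrightarrow> m = n"
| "el_le (At m) (Ar A B) \<longleftrightarrow> (\<exists>b\<in>set B. el_le (At m) b)"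
| "el_le (Ar A B) (At n) \<longleftrightarrow> False"
| "el_le (Ar A B) (Ar A' B') \<longleftrightarrow>
    (\<forall>a\<in>set A. \<exists>a'\<in>set A'. el_le a' a) \<and> (\<forall>b\<in>set B. \<exists>b'\<in>set B'. el_le b b')"
  by pat_completeness auto
termination
\<comment> \<open>The measure is symmetric in the two arguments because the contravariant comparison
  of \<open>A\<close> and \<open>A'\<close> swaps them.\<close>
proof (relation "measure (\<lambda>(x, y). size x + size y)", goal_cases)
  case (2 m A B b) then show ?case using size_list_estimation'[of b B "size b" size] by auto
next
  case (3 A B A' B' x z) then show ?case
    using size_list_estimation'[of x A "size x" size] size_list_estimation'[of z A' "size z" size] by auto
next
  case (4 A B A' B' x z) then show ?case
    using size_list_estimation'[of x B "size x" size] size_list_estimation'[of z B' "size z" size] by auto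
qed auto

lemma el_le_refl: "el_le x x"
  by (induction x) auto

lemma size_mem_Ar:
  "a \<in> set A \<Longrightarrow> size a < size (Ar A B)" "b \<in> set B \<Longrightarrow> size b < size (Ar A B)"
  using size_list_estimation'[of a A "size a" size] size_list_estimation'[of b B "size b" size]
  by auto

text \<open>Induction on the sum of all three sizes: in the arguments of arrows the chain runs
  backwards, so the outer two elements change roles.\<close>

lemma el_le_trans: "el_le x y \<Longrightarrow> el_le y z \<Longrightarrow> el_le x z"
proof (induction "size x + size y + size z" arbitrary: x y z rule: less_induct)
  case less
  have IH: "el_le u w" if "size u + size v + size w < size x + size y + size z" "el_le u v" "el_le v w"
    for u v w using less.hyps that by blast
  show ?case
  proof (cases x)
    case (At m)
    show ?thesis
    proof (cases y)
      case (At n)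
      then show ?thesis using \<open>x = At m\<close> less.prems by simp
    next
      case y: (Ar A B)
      with less.prems obtain A' B' where z: "z = Ar A' B'" by (cases z) auto
      obtain b where b: "b \<in> set B" "el_le x b" using less.prems y At by auto
      then obtain b' where b': "b' \<in> set B'" "el_le b b'" using less.prems y z by auto
      have "el_le x b'"
        using IH[of x b b'] b b' y z size_mem_Ar(2)[of b B A] size_mem_Ar(2)[of b' B' A'] by simp
      then show ?thesis using At z b' by auto
    qed
  next
    case x: (Ar A B)
    then obtain A' B' where y: "y = Ar A' B'" using less.prems by (cases y) auto
    then obtain A'' B'' where z: "z = Ar A'' B''" using less.prems by (cases z) auto
    have "\<exists>a''\<in>set A''. el_le a'' a" if a: "a \<in> set A" for a
    proof -
      obtain a' where a': "a' \<in> set A'" "el_le a' a" using less.prems x y a by auto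
      obtain a'' where a'': "a'' \<in> set A''" "el_le a'' a'" using less.prems y z a' by auto
      show ?thesis
        using IH[of a'' a' a] a a' a'' x y z size_mem_Ar(1)[of a A B] size_mem_Ar(1)[of a' A' B']
          size_mem_Ar(1)[of a'' A'' B''] by auto
    qed
    moreover have "\<exists>b''\<in>set B''. el_le b b''" if b: "b \<in> set B" for b
    proof -
      obtain b' where b': "b' \<in> set B'" "el_le b b'" using less.prems x y b by auto
      obtain b'' where b'': "b'' \<in> set B''" "el_le b' b''" using less.prems y z b' by auto
      show ?thesis
        using IH[of b b' b''] b b' b'' x y z size_mem_Ar(2)[of b B A] size_mem_Ar(2)[of b' B' A']
          size_mem_Ar(2)[of b'' B'' A''] by auto
    qed
    ultimately show ?thesis using x z by simp
  qed
qed

section \<open>Orders on cubes (read as intersections) and clauses (read as unions)\<close>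

definition cube_le :: "el list \<Rightarrow> el list \<Rightarrow> bool" where
  "cube_le A A' \<longleftrightarrow> (\<forall>a'\<in>set A'. \<exists>a\<in>set A. el_le a a')"

definition clause_le :: "el list \<Rightarrow> el list \<Rightarrow> bool" where
  "clause_le B B' \<longleftrightarrow> (\<forall>b\<in>set B. \<exists>b'\<in>set B'. el_le b b')"

lemma cube_le_refl: "cube_le A A" and clause_le_refl: "clause_le A A"
  unfolding cube_le_def clause_le_def using el_le_refl by blast+

lemma cube_le_trans: "cube_le A B \<Longrightarrow> cube_le B C \<Longrightarrow> cube_le A C"
  unfolding cube_le_def by (meson el_le_trans)

lemma clause_le_trans: "clause_le A B \<Longrightarrow> clause_le B C \<Longrightarrow> clause_le A C"
  unfolding clause_le_def by (meson el_le_trans)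

text \<open>The normal form of \<open>\<omega> \<rightarrow> \<phi>\<close> is \<open>\<phi>\<close>, possibly with \<open>\<phi>\<close> repeated in the clause.\<close>

definition const_clause :: "nat \<Rightarrow> el list \<Rightarrow> bool" where
  "const_clause n B \<longleftrightarrow> B \<noteq> [] \<and> (\<forall>b\<in>set B. b = At n)"

definition arr :: "el list \<Rightarrow> el list \<Rightarrow> el" where
  "arr A B = (if A = [] \<and> (\<exists>n. const_clause n B) then hd B else Ar A B)"

lemma arr_atom: "const_clause n B \<Longrightarrow> arr [] B = At n"
  by (auto simp: arr_def) (simp add: const_clause_def)

lemma At_le_arr:
  assumes "b \<in> set B" "el_le (At n) b"
  shows "el_le (At n) (arr A B)"
proof (cases "A = [] \<and> (\<exists>n. const_clause n B)")
  case True
  then obtain m where "A = []" "const_clause m B" by blast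
  moreover from this assms have "b = At m" by (simp add: const_clause_def)
  ultimately show ?thesis using assms by (simp add: arr_atom)
next
  case False
  then have "arr A B = Ar A B" unfolding arr_def by (rule if_not_P)
  with assms show ?thesis by auto
qed

text \<open>The point is that a collapse of the larger side forces a collapse of the smaller one:
  below an empty \<open>A'\<close> only an empty \<open>A\<close> is possible, and only
  \<open>At n\<close> lies below \<open>At n\<close>. A nonempty \<open>B\<close> is then constant;
  an empty one would not be.\<close>

lemma arr_mono:
  assumes A: "cube_le A' A" and B: "clause_le B B'" and ne: "B \<noteq> []"
  shows "el_le (arr A B) (arr A' B')"
proof (cases "A = [] \<and> (\<exists>n. const_clause n B)")
  case True
  then obtain n where n: "A = []" "const_clause n B" by blast
  then have "hd B \<in> set B" "hd B = At n" by (auto simp: const_clause_def)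
  then obtain b' where "b' \<in> set B'" "el_le (At n) b'" using B by (auto simp: clause_le_def)
  then show ?thesis using n At_le_arr by (simp add: arr_atom)
next
  case False
  then have 1: "arr A B = Ar A B" unfolding arr_def by (rule if_not_P)
  have "\<not> (A' = [] \<and> (\<exists>n. const_clause n B'))"
  proof
    assume "A' = [] \<and> (\<exists>n. const_clause n B')"
    then obtain n where n: "A' = []" "const_clause n B'" by blast
    then have "A = []" using A by (cases A) (auto simp: cube_le_def)
    moreover have "b = At n" if "b \<in> set B" for b
    proof -
      obtain b' where "b' \<in> set B'" "el_le b b'" using B \<open>b \<in> set B\<close> by (auto simp: clause_le_def)
      moreover from this n have "b' = At n" by (simp add: const_clause_def)
      ultimately show ?thesis by (cases b) auto
    qed
    then have "const_clause n B" using ne by (simp add: const_clause_def)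
    ultimately show False using False by blast
  qed
  then have "arr A' B' = Ar A' B'" unfolding arr_def by (rule if_not_P)
  with 1 A B show ?thesis by (simp add: cube_le_def clause_le_def)
qed

text \<open>The flag selects clauses (\<open>True\<close>) or cubes (\<open>False\<close>); \<open>\<omega>\<close> has no clause, and the empty cube.\<close>

primrec nf :: "bool \<Rightarrow> ty_expr \<Rightarrow> el list list" where
  "nf p (Atom n) = [[At n]]"
| "nf p \<omega> = (if p then [] else [[]])"
| "nf p (\<sigma> \<rightarrow> \<tau>) =
    (let es = concat (map (\<lambda>A. map (arr A) (nf True \<tau>)) (nf False \<sigma>))
     in if p then map (\<lambda>e. [e]) es else [es])"
| "nf p (\<sigma> \<^bold>\<and> \<tau>) =
    (if p then nf p \<sigma> @ nf p \<tau> else concat (map (\<lambda>A. map ((@) A) (nf p \<tau>)) (nf p \<sigma>)))"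
| "nf p (\<sigma> \<^bold>\<or> \<tau>) =
    (if p then concat (map (\<lambda>A. map ((@) A) (nf p \<tau>)) (nf p \<sigma>)) else nf p \<sigma> @ nf p \<tau>)"

abbreviation "cnf \<equiv> nf True"
abbreviation "dnf \<equiv> nf False"

text \<open>An argument in disjunctive form splits an arrow into an intersection with one arrow per
  cube, and a result in conjunctive form splits it into one arrow per clause. The list is therefore
  a single cube, or a family of unit clauses.\<close>

definition arrows :: "ty_expr \<Rightarrow> ty_expr \<Rightarrow> el list" where
  "arrows \<sigma> \<tau> = concat (map (\<lambda>A. map (arr A) (cnf \<tau>)) (dnf \<sigma>))"

lemma set_arrows: "set (arrows \<sigma> \<tau>) = (\<Union>A\<in>set (dnf \<sigma>). arr A ` set (cnf \<tau>))"
  by (simp add: arrows_def)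

lemma nf_arrow: "nf p (\<sigma> \<rightarrow> \<tau>) = (if p then map (\<lambda>e. [e]) (arrows \<sigma> \<tau>) else [arrows \<sigma> \<tau>])"
  by (simp add: arrows_def Let_def)

declare nf.simps(3) [simp del]

section \<open>Comparing types by their clauses and their cubes\<close>

definition cnf_le :: "ty_expr \<Rightarrow> ty_expr \<Rightarrow> bool" where
  "cnf_le \<sigma> \<tau> \<longleftrightarrow> (\<forall>d\<in>set (cnf \<tau>). \<exists>c\<in>set (cnf \<sigma>). clause_le c d)"

definition dnf_le :: "ty_expr \<Rightarrow> ty_expr \<Rightarrow> bool" where
  "dnf_le \<sigma> \<tau> \<longleftrightarrow> (\<forall>a\<in>set (dnf \<sigma>). \<exists>b\<in>set (dnf \<tau>). cube_le a b)"

text \<open>An empty clause would be an empty union, which no type denotes; \<open>arr_mono\<close>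
  relies on its absence.\<close>

lemma cnf_nonempty: "c \<in> set (cnf \<sigma>) \<Longrightarrow> c \<noteq> []"
  by (induction \<sigma> arbitrary: c) (auto simp: nf_arrow set_arrows)

lemma cnf_le_refl: "cnf_le \<sigma> \<sigma>" and dnf_le_refl: "dnf_le \<sigma> \<sigma>"
  by (auto simp: cnf_le_def dnf_le_def intro: clause_le_refl cube_le_refl)

lemma cnf_le_trans: "cnf_le \<sigma> \<tau> \<Longrightarrow> cnf_le \<tau> \<rho> \<Longrightarrow> cnf_le \<sigma> \<rho>"
  unfolding cnf_le_def by (meson clause_le_trans)

lemma dnf_le_trans: "dnf_le \<sigma> \<tau> \<Longrightarrow> dnf_le \<tau> \<rho> \<Longrightarrow> dnf_le \<sigma> \<rho>"
  unfolding dnf_le_def by (meson cube_le_trans)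

lemma clause_le_append: "clause_le (A @ B) C \<longleftrightarrow> clause_le A C \<and> clause_le B C"
  "clause_le A B \<Longrightarrow> clause_le A (B @ C)" "clause_le A C \<Longrightarrow> clause_le A (B @ C)"
  by (auto simp: clause_le_def)

lemma cube_le_append: "cube_le C (A @ B) \<longleftrightarrow> cube_le C A \<and> cube_le C B"
  "cube_le B A \<Longrightarrow> cube_le (B @ C) A" "cube_le C A \<Longrightarrow> cube_le (B @ C) A"
  by (auto simp: cube_le_def)

lemma cnf_le_cong: "set (cnf \<sigma>) = set (cnf \<tau>) \<Longrightarrow> cnf_le \<sigma> \<tau>"
  using clause_le_refl by (auto simp: cnf_le_def)

lemma dnf_le_cong: "set (dnf \<sigma>) = set (dnf \<tau>) \<Longrightarrow> dnf_le \<sigma> \<tau>"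
  using cube_le_refl by (auto simp: dnf_le_def)

text \<open>Both readings are carried along because an arrow looks at the cubes of its argument and
  at the clauses of its result.\<close>

definition sem_le :: "ty_expr \<Rightarrow> ty_expr \<Rightarrow> bool" where
  "sem_le \<sigma> \<tau> \<longleftrightarrow> cnf_le \<sigma> \<tau> \<and> dnf_le \<sigma> \<tau>"

lemma sem_le_refl: "sem_le \<sigma> \<sigma>"
  by (simp add: sem_le_def cnf_le_refl dnf_le_refl)

lemma sem_le_trans: "sem_le \<sigma> \<tau> \<Longrightarrow> sem_le \<tau> \<rho> \<Longrightarrow> sem_le \<sigma> \<rho>"
  unfolding sem_le_def by (meson cnf_le_trans dnf_le_trans)

lemma cnf_le_inter1: "cnf_le (\<sigma> \<^bold>\<and> \<tau>) \<sigma>" and cnf_le_inter2: "cnf_le (\<sigma> \<^bold>\<and> \<tau>) \<tau>"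
  by (auto simp: cnf_le_def intro: clause_le_refl)

lemma cnf_le_inter: "cnf_le \<sigma> \<tau> \<Longrightarrow> cnf_le \<sigma> \<rho> \<Longrightarrow> cnf_le \<sigma> (\<tau> \<^bold>\<and> \<rho>)"
  by (auto simp: cnf_le_def)

lemma cnf_le_interM: "cnf_le \<sigma> \<sigma>' \<Longrightarrow> cnf_le \<tau> \<tau>' \<Longrightarrow> cnf_le (\<sigma> \<^bold>\<and> \<tau>) (\<sigma>' \<^bold>\<and> \<tau>')"
  by (meson cnf_le_inter cnf_le_inter1 cnf_le_inter2 cnf_le_trans)

lemma sem_le_inter1: "sem_le (\<sigma> \<^bold>\<and> \<tau>) \<sigma>" and sem_le_inter2: "sem_le (\<sigma> \<^bold>\<and> \<tau>) \<tau>"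
  using cnf_le_inter1 cnf_le_inter2
  by (auto simp: sem_le_def dnf_le_def cube_le_append intro: cube_le_refl dest: bspec)
     (metis cube_le_append(2,3) cube_le_refl)+

lemma sem_le_union1: "sem_le \<sigma> (\<sigma> \<^bold>\<or> \<tau>)" and sem_le_union2: "sem_le \<tau> (\<sigma> \<^bold>\<or> \<tau>)"
  by (auto simp: sem_le_def cnf_le_def dnf_le_def intro: cube_le_refl)
     (metis clause_le_append(2,3) clause_le_refl)+

lemma sem_le_inter: "sem_le \<sigma> \<tau> \<Longrightarrow> sem_le \<sigma> \<rho> \<Longrightarrow> sem_le \<sigma> (\<tau> \<^bold>\<and> \<rho>)"
  using cnf_le_inter by (fastforce simp: sem_le_def dnf_le_def cube_le_append)

lemma sem_le_union: "sem_le \<sigma> \<tau> \<Longrightarrow> sem_le \<rho> \<tau> \<Longrightarrow> sem_le (\<sigma> \<^bold>\<or> \<rho>) \<tau>"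
  by (fastforce simp: sem_le_def cnf_le_def dnf_le_def clause_le_append)

text \<open>The two readings of an arrow consist of the same elements, as unit clauses or as one
  cube, so a single comparison of elements settles both.\<close>

lemma sem_le_arrowI:
  assumes "\<And>A' B'. A' \<in> set (dnf \<sigma>') \<Longrightarrow> B' \<in> set (cnf \<tau>') \<Longrightarrow>
    \<exists>A\<in>set (dnf \<sigma>). \<exists>B\<in>set (cnf \<tau>). el_le (arr A B) (arr A' B')"
  shows "sem_le (\<sigma> \<rightarrow> \<tau>) (\<sigma>' \<rightarrow> \<tau>')"
proof -
  have "cnf_le (\<sigma> \<rightarrow> \<tau>) (\<sigma>' \<rightarrow> \<tau>')"
    using assms by (auto simp: cnf_le_def clause_le_def nf_arrow set_arrows)
  moreover have "dnf_le (\<sigma> \<rightarrow> \<tau>) (\<sigma>' \<rightarrow> \<tau>')"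
    using assms by (auto simp: dnf_le_def cube_le_def nf_arrow set_arrows)
  ultimately show ?thesis by (simp add: sem_le_def)
qed

lemma sem_le_arrow:
  assumes "dnf_le \<sigma>' \<sigma>" "cnf_le \<tau> \<tau>'"
  shows "sem_le (\<sigma> \<rightarrow> \<tau>) (\<sigma>' \<rightarrow> \<tau>')"
proof (rule sem_le_arrowI)
  fix A' B' assume "A' \<in> set (dnf \<sigma>')" "B' \<in> set (cnf \<tau>')"
  with assms obtain A B where "A \<in> set (dnf \<sigma>)" "cube_le A' A" "B \<in> set (cnf \<tau>)" "clause_le B B'"
    by (auto simp: cnf_le_def dnf_le_def) blast
  then show "\<exists>A\<in>set (dnf \<sigma>). \<exists>B\<in>set (cnf \<tau>). el_le (arr A B) (arr A' B')"
    using arr_mono cnf_nonempty by blast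
qed

lemma sem_le_atom_arrow: "sem_le (Atom n) (\<sigma> \<rightarrow> Atom n)"
  by (auto simp: sem_le_def cnf_le_def dnf_le_def clause_le_def cube_le_def nf_arrow set_arrows
      intro!: At_le_arr[of "At n"] )

lemma norm_le_imp_sem_le: "\<sigma> \<preceq> \<tau> \<Longrightarrow> sem_le \<sigma> \<tau>"
proof (induction rule: norm_le.induct)
  case (le_omega \<sigma>)
  then show ?case by (auto simp: sem_le_def cnf_le_def dnf_le_def cube_le_def)
next
  \<comment> \<open>As \<open>\<omega>\<close> has no clause,
    \<open>arrows \<sigma> \<omega>\<close> is empty, and the arrow is read exactly like
    \<open>\<omega>\<close>.\<close>
  case (omega_le \<sigma>)
  then show ?case by (auto simp: sem_le_def cnf_le_def dnf_le_def cube_le_def nf_arrow set_arrows)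
next
  case (arrow_mono \<sigma>' \<sigma> \<tau> \<tau>')
  then show ?case by (simp add: sem_le_def[of \<sigma>'] sem_le_def[of \<tau>] sem_le_arrow)
qed (auto intro: sem_le_refl sem_le_trans sem_le_inter1 sem_le_inter2 sem_le_union1 sem_le_union2
    sem_le_inter sem_le_union sem_le_atom_arrow)

section \<open>Invariance of the readings under steps\<close>

definition sem_eq :: "ty_expr \<Rightarrow> ty_expr \<Rightarrow> bool" where
  "sem_eq \<sigma> \<tau> \<longleftrightarrow> sem_le \<sigma> \<tau> \<and> sem_le \<tau> \<sigma>"

lemma sem_eq_cong:
  assumes "\<And>p. set (nf p \<sigma>) = set (nf p \<tau>)"
  shows "sem_eq \<sigma> \<tau>"
  unfolding sem_eq_def sem_le_def
  using cnf_le_cong[OF assms] cnf_le_cong[OF assms[symmetric]]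
    dnf_le_cong[OF assms] dnf_le_cong[OF assms[symmetric]]
  by blast

text \<open>Common core of the rules \<open>arrow_inter\<close> and \<open>union_arrow\<close>: an
  intersection of two arrows pools their elements.\<close>

lemma sem_eq_arrows:
  assumes "set (arrows \<sigma> \<tau>) = set (arrows \<sigma>1 \<tau>1) \<union> set (arrows \<sigma>2 \<tau>2)"
  shows "sem_eq (\<sigma> \<rightarrow> \<tau>) ((\<sigma>1 \<rightarrow> \<tau>1) \<^bold>\<and> (\<sigma>2 \<rightarrow> \<tau>2))"
proof -
  have "set (cnf (\<sigma> \<rightarrow> \<tau>)) = set (cnf ((\<sigma>1 \<rightarrow> \<tau>1) \<^bold>\<and> (\<sigma>2 \<rightarrow> \<tau>2)))"
    by (simp add: nf_arrow assms image_Un)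
  moreover have "cube_le A B" if "set B = set A" for A B
    using that el_le_refl by (auto simp: cube_le_def)
  ultimately show ?thesis unfolding sem_eq_def sem_le_def
    by (simp add: cnf_le_cong dnf_le_def nf_arrow assms)
qed

lemma sem_le_interM: "sem_le \<sigma> \<sigma>' \<Longrightarrow> sem_le \<tau> \<tau>' \<Longrightarrow> sem_le (\<sigma> \<^bold>\<and> \<tau>) (\<sigma>' \<^bold>\<and> \<tau>')"
  by (meson sem_le_inter sem_le_inter1 sem_le_inter2 sem_le_trans)

lemma sem_le_unionM: "sem_le \<sigma> \<sigma>' \<Longrightarrow> sem_le \<tau> \<tau>' \<Longrightarrow> sem_le (\<sigma> \<^bold>\<or> \<tau>) (\<sigma>' \<^bold>\<or> \<tau>')"
  by (meson sem_le_union sem_le_union1 sem_le_union2 sem_le_trans)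

text \<open>Crossing an arrow consumes half of the equivalence, the cubes of an argument or the
  clauses of a result, and restores both halves.\<close>

lemma sem_eq_fill: "sem_eq \<sigma> \<tau> \<Longrightarrow> sem_eq (fill C \<sigma>) (fill C \<tau>)"
proof (induction C)
  case (CArrow1 C \<rho>)
  then show ?case unfolding sem_eq_def fill.simps
    by (intro conjI sem_le_arrow cnf_le_refl) (auto simp: sem_le_def)
next
  case (CArrow2 \<rho> C)
  then show ?case unfolding sem_eq_def fill.simps
    by (intro conjI sem_le_arrow dnf_le_refl) (auto simp: sem_le_def)
qed (auto simp: sem_eq_def intro: sem_le_interM sem_le_unionM sem_le_refl)

lemma inner_step_sem_eq: "\<sigma> \<leadsto> \<tau> \<Longrightarrow> sem_eq \<sigma> \<tau>"
proof (induction rule: inner_step.induct)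
  case (omega_arrow n)
  show ?case
    by (rule sem_eq_cong) (simp add: nf_arrow arrows_def arr_atom const_clause_def)
next
  case (to_omega \<sigma>)
  then show ?case by (simp add: sem_eq_def norm_le_imp_sem_le le_omega)
next
  case (arrow_inter \<sigma> \<tau> \<rho>)
  have "set (arrows \<sigma> (\<tau> \<^bold>\<and> \<rho>)) = set (arrows \<sigma> \<tau>) \<union> set (arrows \<sigma> \<rho>)"
    by (auto simp: set_arrows)
  then show ?case by (rule sem_eq_arrows)
next
  case (union_arrow \<sigma> \<tau> \<rho>)
  have "set (arrows (\<sigma> \<^bold>\<or> \<tau>) \<rho>) = set (arrows \<sigma> \<rho>) \<union> set (arrows \<tau> \<rho>)"
    by (auto simp: set_arrows)
  then show ?case by (rule sem_eq_arrows)
next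
  \<comment> \<open>Distribution in an argument leaves the set of cubes unchanged, and
    \<open>sem_le_arrow\<close> reads an argument through its cubes only. For
    \<open>distr_right\<close> the same holds with the clauses of the result.\<close>
  case (distr_left \<sigma> \<tau> \<rho> \<zeta>)
  have "set (dnf ((\<sigma> \<^bold>\<or> \<tau>) \<^bold>\<and> \<rho>)) = set (dnf ((\<sigma> \<^bold>\<and> \<rho>) \<^bold>\<or> (\<tau> \<^bold>\<and> \<rho>)))" by auto
  then show ?case unfolding sem_eq_def
    by (intro conjI sem_le_arrow) (simp_all only: cnf_le_refl dnf_le_cong)
next
  case (distr_right \<sigma> \<tau> \<rho> \<zeta>)
  have "set (cnf ((\<tau> \<^bold>\<and> \<rho>) \<^bold>\<or> \<zeta>)) = set (cnf ((\<tau> \<^bold>\<or> \<zeta>) \<^bold>\<and> (\<rho> \<^bold>\<or> \<zeta>)))" by auto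
  then show ?case unfolding sem_eq_def
    by (intro conjI sem_le_arrow) (simp_all only: dnf_le_refl cnf_le_cong)
next
  case (erase_inter \<sigma> \<tau>)
  then show ?case by (auto simp: sem_eq_def intro: norm_le_imp_sem_le norm_le.intros)
next
  case (erase_union \<sigma> \<tau>)
  then show ?case by (auto simp: sem_eq_def intro: norm_le_imp_sem_le norm_le.intros)
qed

text \<open>For a whole type the clauses suffice: irreducible types are read back from them, and
  \<open>distr\<close>, which does not act below arrows, keeps them.\<close>

definition cnf_eq :: "ty_expr \<Rightarrow> ty_expr \<Rightarrow> bool" where
  "cnf_eq \<sigma> \<tau> \<longleftrightarrow> cnf_le \<sigma> \<tau> \<and> cnf_le \<tau> \<sigma>"

lemma sem_eq_cnf_eq: "sem_eq \<sigma> \<tau> \<Longrightarrow> cnf_eq \<sigma> \<tau>"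
  by (simp add: sem_eq_def cnf_eq_def sem_le_def)

lemma aci_cnf_eq: "\<sigma> \<approx> \<tau> \<Longrightarrow> cnf_eq \<sigma> \<tau>"
  using aci_imp_le norm_le_imp_sem_le by (auto simp: cnf_eq_def sem_le_def)

lemma top_step_cnf_eq: "top_step \<sigma> \<tau> \<Longrightarrow> cnf_eq \<sigma> \<tau>"
proof (induction rule: top_step.induct)
  case (inner \<sigma> \<tau> C)
  then show ?case by (intro sem_eq_cnf_eq sem_eq_fill inner_step_sem_eq)
next
  case (distr \<sigma> \<tau> \<rho>)
  have "set (cnf ((\<sigma> \<^bold>\<and> \<tau>) \<^bold>\<or> \<rho>)) = set (cnf ((\<sigma> \<^bold>\<or> \<rho>) \<^bold>\<and> (\<tau> \<^bold>\<or> \<rho>)))" by auto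
  then show ?case by (simp only: cnf_eq_def cnf_le_cong simp_thms)
qed (simp_all add: cnf_eq_def cnf_le_interM cnf_le_refl)

subsection \<open>Termination\<close>

text \<open>Under \<open>False\<close> an intersection is a product, so an arrow is made exponential
  there: splitting it into two arrows then only adds exponents. The minimal value 2 makes a product
  exceed its factors and is reserved for \<open>\<omega>\<close>, so that \<open>to_omega\<close>
  decreases the weight.\<close>

primrec weight :: "bool \<Rightarrow> ty_expr \<Rightarrow> nat" where
  "weight p (Atom n) = 3"
| "weight p \<omega> = 2"
| "weight p (\<sigma> \<rightarrow> \<tau>) =
    (if p then weight False \<sigma> * weight True \<tau> else 2 ^ (weight False \<sigma> * weight True \<tau>))"
| "weight p (\<sigma> \<^bold>\<and> \<tau>) = (if p then weight p \<sigma> + weight p \<tau> + 1 else weight p \<sigma> * weight p \<tau>)"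
| "weight p (\<sigma> \<^bold>\<or> \<tau>) = (if p then weight p \<sigma> * weight p \<tau> else weight p \<sigma> + weight p \<tau> + 1)"

lemma mult_ge4: "2 \<le> a \<Longrightarrow> 2 \<le> b \<Longrightarrow> 4 \<le> a * (b::nat)"
  using mult_le_mono[of 2 a 2 b] by simp

lemma pow_ge16: "2 \<le> a \<Longrightarrow> 2 \<le> b \<Longrightarrow> 16 \<le> (2::nat) ^ (a * b)"
  using power_increasing[OF mult_ge4, of a b "2::nat"] by simp

lemma weight_ge2: "2 \<le> weight p \<sigma>"
proof (induction \<sigma> arbitrary: p)
  case (Arrow \<sigma> \<tau>)
  show ?case
    using mult_ge4[OF Arrow.IH(1)[of False] Arrow.IH(2)[of True]]
      pow_ge16[OF Arrow.IH(1)[of False] Arrow.IH(2)[of True]] by simp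
next
  case (Inter \<sigma> \<tau>)
  show ?case using mult_ge4[OF Inter.IH(1)[of p] Inter.IH(2)[of p]] Inter.IH(1)[of p] by (cases p) auto
next
  case (Union \<sigma> \<tau>)
  show ?case using mult_ge4[OF Union.IH(1)[of p] Union.IH(2)[of p]] Union.IH(1)[of p] by (cases p) auto
qed auto

lemma weight_pos: "0 < weight p \<sigma>"
  using weight_ge2[of p \<sigma>] by linarith

lemma weight_omega_less: "\<sigma> \<noteq> \<omega> \<Longrightarrow> 2 < weight p \<sigma>"
proof (cases \<sigma>)
  case (Arrow \<sigma>1 \<sigma>2)
  then show ?thesis
    using mult_ge4[OF weight_ge2[of False \<sigma>1] weight_ge2[of True \<sigma>2]]
      pow_ge16[OF weight_ge2[of False \<sigma>1] weight_ge2[of True \<sigma>2]] by auto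
next
  case (Inter \<sigma>1 \<sigma>2)
  then show ?thesis
    using mult_ge4[OF weight_ge2[of p \<sigma>1] weight_ge2[of p \<sigma>2]] weight_ge2[of p \<sigma>1] by auto
next
  case (Union \<sigma>1 \<sigma>2)
  then show ?thesis
    using mult_ge4[OF weight_ge2[of p \<sigma>1] weight_ge2[of p \<sigma>2]] weight_ge2[of p \<sigma>1] by auto
qed auto

lemma weight_arrow_mono:
  assumes "weight False \<sigma>' * weight True \<tau>' < weight False \<sigma> * weight True \<tau>"
  shows "weight p (\<sigma>' \<rightarrow> \<tau>') < weight p (\<sigma> \<rightarrow> \<tau>)"
  using assms by simp

lemma split_pow_less:
  fixes a b c :: nat
  assumes "a + b + 1 < c"
  shows "(2::nat) ^ a * 2 ^ b < 2 ^ c"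
  using assms by (simp flip: power_add)

text \<open>One condition serves both flags: the summand 1 belongs to the sum reading of the
  intersection, and in the product reading the exponents add.\<close>

lemma weight_split:
  assumes "weight False \<sigma>1 * weight True \<tau>1 + weight False \<sigma>2 * weight True \<tau>2 + 1
    < weight False \<sigma> * weight True \<tau>"
  shows "weight p ((\<sigma>1 \<rightarrow> \<tau>1) \<^bold>\<and> (\<sigma>2 \<rightarrow> \<tau>2)) < weight p (\<sigma> \<rightarrow> \<tau>)"
  using assms split_pow_less[OF assms] by simp

lemma inner_step_weight: "\<sigma> \<leadsto> \<tau> \<Longrightarrow> weight p \<tau> < weight p \<sigma>"
proof (induction arbitrary: p rule: inner_step.induct)
  case (to_omega \<sigma>)
  then have "\<sigma> \<noteq> \<omega>" using aci.refl by blast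
  then show ?case using weight_omega_less by simp
next
  case (arrow_inter \<sigma> \<tau> \<rho>)
  show ?case
    by (rule weight_split) (use weight_ge2[of False \<sigma>] in \<open>simp add: algebra_simps\<close>)
next
  case (union_arrow \<sigma> \<tau> \<rho>)
  show ?case
    by (rule weight_split) (use weight_ge2[of True \<rho>] in \<open>simp add: algebra_simps\<close>)
next
  \<comment> \<open>With \<open>s\<close>, \<open>t\<close>, \<open>r\<close> the
    \<open>False\<close> weights, the argument weighs \<open>(s + t + 1) * r\<close> before and
    \<open>s * r + t * r + 1\<close> after; the gain comes from \<open>r\<close> being at least
    2.\<close>
  case (distr_left \<sigma> \<tau> \<rho> \<zeta>)
  show ?case
    by (rule weight_arrow_mono)
      (use weight_ge2[of False \<rho>] weight_pos[of True \<zeta>] in \<open>simp add: algebra_simps\<close>)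
next
  case (distr_right \<sigma> \<tau> \<rho> \<zeta>)
  show ?case
    by (rule weight_arrow_mono)
      (use weight_ge2[of True \<zeta>] weight_pos[of False \<sigma>] in \<open>simp add: algebra_simps\<close>)
next
  case (erase_inter \<sigma> \<tau>)
  show ?case using weight_ge2[of p \<tau>] weight_pos[of p \<sigma>] by (cases p) auto
next
  case (erase_union \<sigma> \<tau>)
  show ?case using weight_ge2[of p \<sigma>] weight_pos[of p \<tau>] by (cases p) auto
qed auto

text \<open>The decrease is required under both flags because every arrow between the root and the
  hole resets the flag.\<close>

lemma weight_fill:
  "(\<And>p. weight p \<tau> < weight p \<sigma>) \<Longrightarrow> weight p (fill C \<tau>) < weight p (fill C \<sigma>)"
  by (induction C arbitrary: p) (simp_all add: weight_pos)

text \<open>Restricted to \<open>True\<close>, since \<open>distr\<close> increases the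
  \<open>False\<close> weight. The rules \<open>inter1\<close> and \<open>inter2\<close> stay within
  \<open>True\<close>, as the members of an intersection inherit the flag.\<close>

lemma top_step_weight: "top_step \<sigma> \<tau> \<Longrightarrow> weight True \<tau> < weight True \<sigma>"
proof (induction rule: top_step.induct)
  case (inner \<sigma> \<tau> C)
  then show ?case by (intro weight_fill inner_step_weight)
next
  case (distr \<sigma> \<tau> \<rho>)
  then show ?case using weight_ge2[of True \<rho>] by (simp add: algebra_simps)
qed simp_all

text \<open>Canonical representatives of the classes of \<open>\<approx>\<close>: the flag of \<open>CLat\<close> is \<open>True\<close> for intersections
  and \<open>False\<close> for unions, and likewise for \<open>bin\<close>, \<open>mems\<close> and \<open>big\<close> below.\<close>

datatype cn = CAtom nat | COmega | CArrow cn cn | CLat bool "cn fset"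

primrec members :: "bool \<Rightarrow> cn \<Rightarrow> cn fset" where
  "members b (CAtom n) = {|CAtom n|}"
| "members b COmega = {|COmega|}"
| "members b (CArrow x y) = {|CArrow x y|}"
| "members b (CLat b' S) = (if b = b' then S else {|CLat b' S|})"

definition lat :: "bool \<Rightarrow> cn fset \<Rightarrow> cn" where
  "lat b S = (if \<exists>z. S = {|z|} then fthe_elem S else CLat b S)"

lemma lat_singleton [simp]: "lat b {|z|} = z"
  by (auto simp: lat_def)

text \<open>Merging nodes with the same flag yields associativity, the finite set commutativity, and
  unwrapping singletons in \<open>lat\<close> idempotence.\<close>

definition join :: "bool \<Rightarrow> cn \<Rightarrow> cn \<Rightarrow> cn" where
  "join b x y = lat b (members b x |\<union>| members b y)"

primrec canon :: "ty_expr \<Rightarrow> cn" where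
  "canon (Atom n) = CAtom n"
| "canon \<omega> = COmega"
| "canon (\<sigma> \<rightarrow> \<tau>) = CArrow (canon \<sigma>) (canon \<tau>)"
| "canon (\<sigma> \<^bold>\<and> \<tau>) = join True (canon \<sigma>) (canon \<tau>)"
| "canon (\<sigma> \<^bold>\<or> \<tau>) = join False (canon \<sigma>) (canon \<tau>)"

text \<open>The shape of canonical forms: a lattice node has at least two members, and none of them
  is a node with the same flag, which is the content of \<open>members b x = {|x|}\<close>.\<close>

inductive flat :: "cn \<Rightarrow> bool" where
  "flat (CAtom n)"
| "flat COmega"
| "flat x \<Longrightarrow> flat y \<Longrightarrow> flat (CArrow x y)"
| "(\<And>x. x |\<in>| S \<Longrightarrow> flat x) \<Longrightarrow> (\<And>x. x |\<in>| S \<Longrightarrow> members b x = {|x|}) \<Longrightarrow>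
    S \<noteq> {||} \<Longrightarrow> (\<And>z. S \<noteq> {|z|}) \<Longrightarrow> flat (CLat b S)"

definition flat_set :: "bool \<Rightarrow> cn fset \<Rightarrow> bool" where
  "flat_set b S \<longleftrightarrow> S \<noteq> {||} \<and> (\<forall>x. x |\<in>| S \<longrightarrow> flat x \<and> members b x = {|x|})"

lemma lat_cases:
  assumes "flat_set b S"
  obtains z where "S = {|z|}" "lat b S = z" "flat z" "members b z = {|z|}"
  | "lat b S = CLat b S" "flat (CLat b S)"
  using assms that unfolding flat_set_def
  by (cases "\<exists>z. S = {|z|}") (auto simp: lat_def intro!: flat.intros)

lemma flat_lat: "flat_set b S \<Longrightarrow> flat (lat b S)"
  by (erule lat_cases) simp_all

lemma members_lat:
  assumes "flat_set b S"
  shows "members b (lat b S) = S"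
  using assms
proof (cases rule: lat_cases)
  case (1 z)
  show ?thesis by (simp add: 1(1,4))
next
  case 2
  show ?thesis unfolding 2(1) by simp
qed

lemma flat_members:
  assumes "flat x"
  shows "flat_set b (members b x)"
  using assms
proof cases
  case (4 S b')
  show ?thesis
  proof (cases "b = b'")
    case True
    with 4 show ?thesis by (simp add: flat_set_def)
  next
    case False
    with 4 assms show ?thesis by (simp add: flat_set_def)
  qed
qed (use assms in \<open>simp_all add: flat_set_def\<close>)

lemma members_nonempty: "flat x \<Longrightarrow> members b x \<noteq> {||}"
  using flat_members unfolding flat_set_def by blast

lemma lat_members: "flat x \<Longrightarrow> lat b (members b x) = x"
  by (induction rule: flat.induct) (auto simp: lat_def)

lemma flat_set_Un: "flat_set b S \<Longrightarrow> flat_set b T \<Longrightarrow> flat_set b (S |\<union>| T)"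
  by (auto simp: flat_set_def)

lemma flat_join: "flat x \<Longrightarrow> flat y \<Longrightarrow> flat (join b x y)"
  by (simp add: join_def flat_lat flat_set_Un flat_members)

lemma members_join:
  "flat x \<Longrightarrow> flat y \<Longrightarrow> members b (join b x y) = members b x |\<union>| members b y"
  by (simp add: join_def members_lat flat_set_Un flat_members)

lemma flat_canon: "flat (canon \<sigma>)"
  by (induction \<sigma>) (auto intro: flat.intros flat_join)

lemma aci_canon: "\<sigma> \<approx> \<tau> \<Longrightarrow> canon \<sigma> = canon \<tau>"
proof (induction rule: aci.induct)
  case (assoc_inter \<sigma> \<tau> \<rho>)
  then show ?case
    by (simp add: join_def[of _ "join _ _ _"] join_def[of _ _ "join _ _ _"] members_join flat_canon
        funion_assoc)
next
  case (assoc_union \<sigma> \<tau> \<rho>)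
  then show ?case
    by (simp add: join_def[of _ "join _ _ _"] join_def[of _ _ "join _ _ _"] members_join flat_canon
        funion_assoc)
qed (auto simp: join_def funion_commute lat_members flat_canon)

section \<open>Reading canonical forms as types\<close>

lift_definition ty_arrow :: "ty \<Rightarrow> ty \<Rightarrow> ty" is Arrow by (rule aci.cong_arrow)
lift_definition ty_inter :: "ty \<Rightarrow> ty \<Rightarrow> ty" is Inter by (rule aci.cong_inter)
lift_definition ty_union :: "ty \<Rightarrow> ty \<Rightarrow> ty" is Union by (rule aci.cong_union)

definition ty_lat :: "bool \<Rightarrow> ty \<Rightarrow> ty \<Rightarrow> ty" where
  "ty_lat b = (if b then ty_inter else ty_union)"

lemma semilattice_inter: "semilattice_set ty_inter"
  by standard (transfer; blast intro: aci.intros)+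

lemma semilattice_union: "semilattice_set ty_union"
  by standard (transfer; blast intro: aci.intros)+

lemma semilattice_ty_lat: "semilattice_set (ty_lat b)"
  by (simp add: ty_lat_def semilattice_inter semilattice_union)

abbreviation "big_lat b \<equiv> semilattice_set.F (ty_lat b)"

text \<open>A left inverse of \<open>canon\<close> at the level of classes. Folding over a set of
  members is well defined because both operations are semilattices on types.\<close>

primrec ty_of_cn :: "cn \<Rightarrow> ty" where
  "ty_of_cn (CAtom n) = abs_ty (Atom n)"
| "ty_of_cn COmega = abs_ty \<omega>"
| "ty_of_cn (CArrow x y) = ty_arrow (ty_of_cn x) (ty_of_cn y)"
| "ty_of_cn (CLat b S) = big_lat b (fset (fimage ty_of_cn S))"

lemma big_lat_singleton: "big_lat b {x} = x"
  by (rule semilattice_set.singleton[OF semilattice_ty_lat])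

lemma ty_of_cn_members: "ty_of_cn x = big_lat b (ty_of_cn ` fset (members b x))"
  by (cases x) (auto simp: big_lat_singleton)

lemma ty_of_cn_lat: "ty_of_cn (lat b S) = big_lat b (ty_of_cn ` fset S)"
  by (cases "\<exists>z. S = {|z|}") (auto simp: lat_def big_lat_singleton)

lemma ty_of_cn_join:
  assumes "flat x" "flat y"
  shows "ty_of_cn (join b x y) = ty_lat b (ty_of_cn x) (ty_of_cn y)"
proof -
  let ?X = "ty_of_cn ` fset (members b x)" and ?Y = "ty_of_cn ` fset (members b y)"
  have "members b x \<noteq> {||}" "members b y \<noteq> {||}"
    using assms members_nonempty by blast+
  then have "?X \<noteq> {}" "?Y \<noteq> {}" by auto
  then have "big_lat b (?X \<union> ?Y) = ty_lat b (big_lat b ?X) (big_lat b ?Y)"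
    by (intro semilattice_set.union[OF semilattice_ty_lat]) auto
  then show ?thesis
    unfolding join_def ty_of_cn_lat union_fset image_Un
      ty_of_cn_members[of x b, symmetric] ty_of_cn_members[of y b, symmetric] .
qed

lemma ty_of_cn_canon: "ty_of_cn (canon \<sigma>) = abs_ty \<sigma>"
  by (induction \<sigma>)
    (simp_all add: ty_of_cn_join flat_canon ty_lat_def ty_arrow.abs_eq ty_inter.abs_eq
      ty_union.abs_eq)

section \<open>Size and weight of canonical forms\<close>

lemma size_mem_CLat: "x |\<in>| S \<Longrightarrow> size x < size (CLat b S)"
  by (auto simp: less_Suc_eq_le intro!: order_trans[OF _ member_le_sum[of x]])

text \<open>The least size within a class. Joining \<open>n\<close> members takes
  \<open>n - 1\<close> binary operations, hence one per member and a final subtraction, which does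
  not truncate when there is a member.\<close>

function cn_size :: "cn \<Rightarrow> nat" where
  "cn_size (CAtom n) = size (Atom n)"
| "cn_size COmega = size \<omega>"
| "cn_size (CArrow x y) = cn_size x + cn_size y + 1"
| "cn_size (CLat b S) = (\<Sum>x\<in>fset S. cn_size x + 1) - 1"
  by pat_completeness auto
termination
  by (relation "measure size") (simp_all add: size_mem_CLat del: cn.size(4) cn.size(8))

function cn_weight :: "bool \<Rightarrow> cn \<Rightarrow> nat" where
  "cn_weight p (CAtom n) = 3"
| "cn_weight p COmega = 2"
| "cn_weight p (CArrow x y) =
    (if p then cn_weight False x * cn_weight True y else 2 ^ (cn_weight False x * cn_weight True y))"
| "cn_weight p (CLat b S) =
    (if p = b then (\<Sum>x\<in>fset S. cn_weight p x + 1) - 1 else (\<Prod>x\<in>fset S. cn_weight p x))"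
  by pat_completeness auto
termination
  by (relation "measure (size \<circ> snd)") (simp_all add: size_mem_CLat del: cn.size(4) cn.size(8))

text \<open>Stated for an abstract \<open>f\<close> that covers both \<open>cn_size\<close> and
  \<open>cn_weight b\<close>: it is \<open>f x + 1\<close> that is additive over members.\<close>

lemma sum_members:
  fixes f :: "cn \<Rightarrow> nat"
  assumes f: "\<And>S. f (CLat b S) = (\<Sum>x\<in>fset S. f x + 1) - 1" and x: "flat x"
  shows "(\<Sum>z\<in>fset (members b x). f z + 1) = f x + 1"
proof (cases "\<exists>S. x = CLat b S")
  case True
  then obtain S where S: "x = CLat b S" by blast
  then have "fset S \<noteq> {}" using members_nonempty[OF x, of b] by auto
  then have "(\<Sum>x\<in>fset S. f x + 1) \<noteq> 0" by simp
  then have "f (CLat b S) + 1 = (\<Sum>x\<in>fset S. f x + 1)" unfolding f by linarith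
  then show ?thesis by (simp add: S)
next
  case False
  then show ?thesis by (cases x) auto
qed

lemma sum_lat:
  fixes f :: "cn \<Rightarrow> nat"
  assumes f: "\<And>S. f (CLat b S) = (\<Sum>x\<in>fset S. f x + 1) - 1" and ne: "S \<noteq> {||}"
  shows "f (lat b S) + 1 = (\<Sum>z\<in>fset S. f z + 1)"
proof (cases "\<exists>z. S = {|z|}")
  case True
  then show ?thesis by auto
next
  case False
  have "fset S \<noteq> {}" using ne by auto
  then have "(\<Sum>x\<in>fset S. f x + 1) \<noteq> 0" by simp
  then have "f (CLat b S) + 1 = (\<Sum>x\<in>fset S. f x + 1)" unfolding f by linarith
  then show ?thesis using False by (simp add: lat_def)
qed

text \<open>Inclusion-exclusion: the set union identifies common members, so the sum over them is
  exactly what a join loses. The lemma \<open>prod_join\<close> is the multiplicative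
  counterpart.\<close>

lemma sum_join:
  fixes f :: "cn \<Rightarrow> nat"
  assumes f: "\<And>S. f (CLat b S) = (\<Sum>x\<in>fset S. f x + 1) - 1" and x: "flat x" and y: "flat y"
  shows "f (join b x y) + (\<Sum>z\<in>fset (members b x) \<inter> fset (members b y). f z + 1) = f x + f y + 1"
proof -
  have "f (join b x y) + 1 = (\<Sum>z\<in>fset (members b x) \<union> fset (members b y). f z + 1)"
    unfolding join_def using members_nonempty[OF x] by (subst sum_lat[of f b, OF f]) auto
  moreover have "(\<Sum>z\<in>fset (members b x) \<union> fset (members b y). f z + 1) +
      (\<Sum>z\<in>fset (members b x) \<inter> fset (members b y). f z + 1) = (f x + 1) + (f y + 1)"
    unfolding sum_members[of f b, OF f x, symmetric] sum_members[of f b, OF f y, symmetric]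
    by (rule sum.union_inter) auto
  ultimately show ?thesis by linarith
qed

lemma prod_join:
  fixes f :: "cn \<Rightarrow> nat"
  assumes f: "\<And>S. f (CLat b S) = (\<Prod>x\<in>fset S. f x)"
  shows "f (join b x y) * (\<Prod>z\<in>fset (members b x) \<inter> fset (members b y). f z) = f x * f y"
proof -
  have mem: "(\<Prod>z\<in>fset (members b x). f z) = f x" for x by (cases x) (auto simp: f)
  have "f (join b x y) = (\<Prod>z\<in>fset (members b x) \<union> fset (members b y). f z)"
    by (auto simp: join_def lat_def f simp flip: union_fset)
  moreover have "(\<Prod>z\<in>fset (members b x) \<union> fset (members b y). f z) *
      (\<Prod>z\<in>fset (members b x) \<inter> fset (members b y). f z) = f x * f y"
    unfolding mem[of x, symmetric] mem[of y, symmetric]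
    by (rule prod.union_inter) auto
  ultimately show ?thesis by simp
qed

lemma cn_weight_pos: "flat x \<Longrightarrow> 0 < cn_weight p x"
proof (induction arbitrary: p rule: flat.induct)
  case (4 S b)
  then obtain z where z: "z \<in> fset S" by auto
  have "cn_weight b z + 1 \<le> (\<Sum>x\<in>fset S. cn_weight b x + 1)"
    using z by (intro member_le_sum[of z "fset S" "\<lambda>x. cn_weight b x + 1"]) auto
  moreover have "0 < cn_weight b z" using 4 z by blast
  ultimately have "0 < (\<Sum>x\<in>fset S. cn_weight b x + 1) - 1" by linarith
  moreover have "0 < (\<Prod>x\<in>fset S. cn_weight p x)" using 4 by (intro prod_pos) blast
  ultimately show ?case
    by (cases "p = b") (simp_all only: cn_weight.simps if_True if_False simp_thms)
qed auto

text \<open>Contracting repetitions cannot raise size or weights. The last part links the two: every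
  common member costs at least 1 in size, so an exact size rules out common members and makes the
  weights exact too.\<close>

lemma join_bound:
  assumes x: "flat x" and y: "flat y"
  shows "cn_size (join b x y) \<le> cn_size x + cn_size y + 1"
    and "cn_weight b (join b x y) \<le> cn_weight b x + cn_weight b y + 1"
    and "cn_weight (\<not> b) (join b x y) \<le> cn_weight (\<not> b) x * cn_weight (\<not> b) y"
    and "cn_size (join b x y) = cn_size x + cn_size y + 1 \<Longrightarrow>
      cn_weight b (join b x y) = cn_weight b x + cn_weight b y + 1 \<and>
      cn_weight (\<not> b) (join b x y) = cn_weight (\<not> b) x * cn_weight (\<not> b) y"
proof -
  let ?I = "fset (members b x) \<inter> fset (members b y)"
  have s: "cn_size (join b x y) + (\<Sum>z\<in>?I. cn_size z + 1) = cn_size x + cn_size y + 1"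
    by (rule sum_join) (use x y in simp_all)
  have w: "cn_weight b (join b x y) + (\<Sum>z\<in>?I. cn_weight b z + 1) =
      cn_weight b x + cn_weight b y + 1"
    by (rule sum_join) (use x y in simp_all)
  have v: "cn_weight (\<not> b) (join b x y) * (\<Prod>z\<in>?I. cn_weight (\<not> b) z) =
      cn_weight (\<not> b) x * cn_weight (\<not> b) y"
    by (rule prod_join) simp
  show "cn_size (join b x y) \<le> cn_size x + cn_size y + 1" using s by linarith
  show "cn_weight b (join b x y) \<le> cn_weight b x + cn_weight b y + 1" using w by linarith
  have "flat z" if "z \<in> ?I" for z
    using that flat_members[OF x, of b] unfolding flat_set_def by blast
  then have "0 < (\<Prod>z\<in>?I. cn_weight (\<not> b) z)" by (intro prod_pos) (blast intro: cn_weight_pos)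
  then have "cn_weight (\<not> b) (join b x y) * 1 \<le>
      cn_weight (\<not> b) (join b x y) * (\<Prod>z\<in>?I. cn_weight (\<not> b) z)"
    by (intro mult_le_mono2) linarith
  then show "cn_weight (\<not> b) (join b x y) \<le> cn_weight (\<not> b) x * cn_weight (\<not> b) y"
    unfolding v by simp
  assume "cn_size (join b x y) = cn_size x + cn_size y + 1"
  then have "(\<Sum>z\<in>?I. cn_size z + 1) = 0" using s by linarith
  then have "?I = {}" by auto
  then show "cn_weight b (join b x y) = cn_weight b x + cn_weight b y + 1 \<and>
      cn_weight (\<not> b) (join b x y) = cn_weight (\<not> b) x * cn_weight (\<not> b) y"
    using w v by (metis (no_types, lifting) add.right_neutral mult.right_neutral prod.empty sum.empty)
qed

text \<open>The equality case descends to the operands because sizes add up: if the total is exact,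
  so is each part, and so is the join.\<close>

lemma canon_bound:
  "cn_size (canon \<sigma>) \<le> size \<sigma> \<and> (\<forall>p. cn_weight p (canon \<sigma>) \<le> weight p \<sigma>) \<and>
   (cn_size (canon \<sigma>) = size \<sigma> \<longrightarrow> (\<forall>p. cn_weight p (canon \<sigma>) = weight p \<sigma>))"
proof (induction \<sigma>)
  case (Arrow \<sigma> \<tau>)
  have "cn_weight False (canon \<sigma>) * cn_weight True (canon \<tau>) \<le> weight False \<sigma> * weight True \<tau>"
    using Arrow by (intro mult_le_mono) auto
  then show ?case using Arrow by auto
next
  case (Inter \<sigma> \<tau>)
  note b = join_bound[OF flat_canon flat_canon, of True \<sigma> \<tau>, simplified not_True_eq_False]
  have p: "cn_weight False (canon \<sigma>) * cn_weight False (canon \<tau>) \<le> weight False \<sigma> * weight False \<tau>"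
    using Inter by (intro mult_le_mono) auto
  have q: "cn_weight True (canon \<sigma>) \<le> weight True \<sigma>" "cn_weight True (canon \<tau>) \<le> weight True \<tau>"
    using Inter by auto
  have 1: "cn_size (canon (\<sigma> \<^bold>\<and> \<tau>)) \<le> size (\<sigma> \<^bold>\<and> \<tau>)" using Inter b(1) by simp
  have 2: "cn_weight p (canon (\<sigma> \<^bold>\<and> \<tau>)) \<le> weight p (\<sigma> \<^bold>\<and> \<tau>)" for p
    using p q b(2,3) by (cases p) simp_all
  have "cn_weight p (canon (\<sigma> \<^bold>\<and> \<tau>)) = weight p (\<sigma> \<^bold>\<and> \<tau>)"
    if "cn_size (canon (\<sigma> \<^bold>\<and> \<tau>)) = size (\<sigma> \<^bold>\<and> \<tau>)" for p
  proof -
    have "cn_size (canon \<sigma>) = size \<sigma>" "cn_size (canon \<tau>) = size \<tau>"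
      "cn_size (join True (canon \<sigma>) (canon \<tau>)) = cn_size (canon \<sigma>) + cn_size (canon \<tau>) + 1"
      using that Inter b(1) by auto
    with b(4) Inter show ?thesis by (cases p) simp_all
  qed
  with 1 2 show ?case by blast
next
  case (Union \<sigma> \<tau>)
  note b = join_bound[OF flat_canon flat_canon, of False \<sigma> \<tau>, simplified not_False_eq_True]
  have p: "cn_weight True (canon \<sigma>) * cn_weight True (canon \<tau>) \<le> weight True \<sigma> * weight True \<tau>"
    using Union by (intro mult_le_mono) auto
  have q: "cn_weight False (canon \<sigma>) \<le> weight False \<sigma>" "cn_weight False (canon \<tau>) \<le> weight False \<tau>"
    using Union by auto
  have 1: "cn_size (canon (\<sigma> \<^bold>\<or> \<tau>)) \<le> size (\<sigma> \<^bold>\<or> \<tau>)" using Union b(1) by simp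
  have 2: "cn_weight p (canon (\<sigma> \<^bold>\<or> \<tau>)) \<le> weight p (\<sigma> \<^bold>\<or> \<tau>)" for p
    using p q b(2,3) by (cases p) simp_all
  have "cn_weight p (canon (\<sigma> \<^bold>\<or> \<tau>)) = weight p (\<sigma> \<^bold>\<or> \<tau>)"
    if "cn_size (canon (\<sigma> \<^bold>\<or> \<tau>)) = size (\<sigma> \<^bold>\<or> \<tau>)" for p
  proof -
    have "cn_size (canon \<sigma>) = size \<sigma>" "cn_size (canon \<tau>) = size \<tau>"
      "cn_size (join False (canon \<sigma>) (canon \<tau>)) = cn_size (canon \<sigma>) + cn_size (canon \<tau>) + 1"
      using that Union b(1) by auto
    with b(4) Union show ?thesis by (cases p) simp_all
  qed
  with 1 2 show ?case by blast
qed auto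

lemma big_lat_expr:
  assumes "finite S" "S \<noteq> {}"
    and "\<And>x. x \<in> S \<Longrightarrow> \<exists>\<sigma>. abs_ty \<sigma> = ty_of_cn x \<and> size \<sigma> = cn_size x"
  shows "\<exists>\<sigma>. abs_ty \<sigma> = big_lat b (ty_of_cn ` S) \<and> size \<sigma> + 1 = (\<Sum>x\<in>S. cn_size x + 1)"
  using assms
proof (induction rule: finite_ne_induct)
  case (singleton x)
  then obtain \<sigma> where "abs_ty \<sigma> = ty_of_cn x" "size \<sigma> = cn_size x" by blast
  then show ?case by (intro exI[of _ \<sigma>]) (simp add: big_lat_singleton)
next
  case (insert x F)
  obtain \<sigma> where \<sigma>: "abs_ty \<sigma> = ty_of_cn x" "size \<sigma> = cn_size x" using insert.prems by blast
  obtain \<tau> where \<tau>: "abs_ty \<tau> = big_lat b (ty_of_cn ` F)" "size \<tau> + 1 = (\<Sum>x\<in>F. cn_size x + 1)"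
    using insert.IH insert.prems by blast
  have "big_lat b (ty_of_cn ` insert x F) = ty_lat b (ty_of_cn x) (big_lat b (ty_of_cn ` F))"
    unfolding image_insert using insert.hyps
    by (intro semilattice_set.insert[OF semilattice_ty_lat]) auto
  then have *: "big_lat b (ty_of_cn ` insert x F) = ty_lat b (abs_ty \<sigma>) (abs_ty \<tau>)"
    by (simp only: \<sigma>(1) \<tau>(1))
  have sum: "(\<Sum>x\<in>insert x F. cn_size x + 1) = size \<sigma> + 1 + (size \<tau> + 1)"
    using insert.hyps \<sigma>(2) \<tau>(2) by simp
  show ?case unfolding * sum
  proof (cases b)
    case True
    then show "\<exists>\<rho>. abs_ty \<rho> = ty_lat b (abs_ty \<sigma>) (abs_ty \<tau>) \<and> size \<rho> + 1 = size \<sigma> + 1 + (size \<tau> + 1)"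
      by (intro exI[of _ "\<sigma> \<^bold>\<and> \<tau>"]) (simp add: ty_lat_def ty_inter.abs_eq)
  next
    case False
    then show "\<exists>\<rho>. abs_ty \<rho> = ty_lat b (abs_ty \<sigma>) (abs_ty \<tau>) \<and> size \<rho> + 1 = size \<sigma> + 1 + (size \<tau> + 1)"
      by (intro exI[of _ "\<sigma> \<^bold>\<or> \<tau>"]) (simp add: ty_lat_def ty_union.abs_eq)
  qed
qed

text \<open>The lower bound on sizes in \<open>canon_bound\<close> is attained, so minimal size
  means size \<open>cn_size\<close> of the canonical form.\<close>

lemma ty_of_cn_expr: "flat x \<Longrightarrow> \<exists>\<sigma>. abs_ty \<sigma> = ty_of_cn x \<and> size \<sigma> = cn_size x"
proof (induction rule: flat.induct)
  case (3 x y)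
  then obtain \<sigma> \<tau> where "abs_ty \<sigma> = ty_of_cn x" "size \<sigma> = cn_size x"
    "abs_ty \<tau> = ty_of_cn y" "size \<tau> = cn_size y" by blast
  then show ?case by (intro exI[of _ "\<sigma> \<rightarrow> \<tau>"]) (simp flip: ty_arrow.abs_eq)
next
  case (4 S b)
  have "\<exists>\<sigma>. abs_ty \<sigma> = big_lat b (ty_of_cn ` fset S) \<and> size \<sigma> + 1 = (\<Sum>x\<in>fset S. cn_size x + 1)"
    using 4 by (intro big_lat_expr) auto
  then obtain \<sigma> where "abs_ty \<sigma> = big_lat b (ty_of_cn ` fset S)"
    "size \<sigma> + 1 = (\<Sum>x\<in>fset S. cn_size x + 1)" by blast
  moreover from this have "size \<sigma> = cn_size (CLat b S)" unfolding cn_size.simps by linarith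
  ultimately show ?case by (intro exI[of _ \<sigma>]) simp
qed (metis ty_of_cn.simps cn_size.simps)+

text \<open>Minimality of the size puts the expression into the equality case of
  \<open>canon_bound\<close>.\<close>

lemma irredundant_weight:
  assumes "irredundant \<sigma>"
  shows "weight p \<sigma> = cn_weight p (canon \<sigma>)"
proof -
  obtain \<sigma>' where "abs_ty \<sigma>' = abs_ty \<sigma>" and size: "size \<sigma>' = cn_size (canon \<sigma>)"
    using ty_of_cn_expr[OF flat_canon] ty_of_cn_canon by metis
  then have "\<sigma> \<approx> \<sigma>'" by (metis ty.abs_eq_iff)
  then have "size \<sigma> \<le> cn_size (canon \<sigma>)" using assms size by (auto simp: irredundant_def)
  then show ?thesis using canon_bound[of \<sigma>] by auto
qed

section \<open>The weight of a type, and termination\<close>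

definition ty_weight :: "ty \<Rightarrow> nat" where
  "ty_weight X = cn_weight True (canon (rep_ty X))"

lemma ty_weight_abs: "ty_weight (abs_ty \<sigma>) = cn_weight True (canon \<sigma>)"
proof -
  have "canon (rep_ty (abs_ty \<sigma>)) = canon \<sigma>"
    by (intro aci_canon) (simp add: ty.abs_eq_iff[symmetric] Quotient3_abs_rep[OF Quotient3_ty])
  then show ?thesis by (simp add: ty_weight_def)
qed

text \<open>The source is irredundant and so has exactly the weight of its type. The target may
  contain repetitions, but contracting them can only lower its weight further.\<close>

lemma top_red_weight:
  assumes "X \<Longrightarrow>\<^sub>t Y"
  shows "ty_weight Y < ty_weight X"
proof -
  obtain \<sigma> \<tau> where XY: "X = abs_ty \<sigma>" "Y = abs_ty \<tau>" and "irredundant \<sigma>" "top_step \<sigma> \<tau>"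
    using assms unfolding top_red_def by blast
  then have "weight True \<tau> < cn_weight True (canon \<sigma>)"
    using top_step_weight irredundant_weight by metis
  then show ?thesis using canon_bound[of \<tau>] unfolding XY ty_weight_abs
    by (meson le_less_trans)
qed

lemma wfp_top_red: "wfp (\<lambda>Y X. X \<Longrightarrow>\<^sub>t Y)"
  by (rule wfp_if_convertible_to_nat[of _ ty_weight]) (rule top_red_weight)

lemma terminating_top_red: "terminating (\<Longrightarrow>\<^sub>t)"
  using wfp_top_red unfolding terminating_def wfp_def wf_iff_no_infinite_down_chain by auto

subsection \<open>Irreducible types\<close>

definition bin :: "bool \<Rightarrow> ty_expr \<Rightarrow> ty_expr \<Rightarrow> ty_expr" where
  "bin b \<sigma> \<tau> = (if b then \<sigma> \<^bold>\<and> \<tau> else \<sigma> \<^bold>\<or> \<tau>)"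

lemma aci_iff: "\<sigma> \<approx> \<tau> \<longleftrightarrow> abs_ty \<sigma> = abs_ty \<tau>"
  by (rule ty.abs_eq_iff[symmetric])

lemma abs_bin: "abs_ty (bin b \<sigma> \<tau>) = ty_lat b (abs_ty \<sigma>) (abs_ty \<tau>)"
  by (simp add: bin_def ty_lat_def ty_inter.abs_eq ty_union.abs_eq)

lemma abs_arrow: "abs_ty (\<sigma> \<rightarrow> \<tau>) = ty_arrow (abs_ty \<sigma>) (abs_ty \<tau>)"
  by (simp add: ty_arrow.abs_eq)

lemma ty_lat_ac:
  "ty_lat b (ty_lat b X Y) Z = ty_lat b X (ty_lat b Y Z)"
  "ty_lat b X Y = ty_lat b Y X"
  "ty_lat b X (ty_lat b Y Z) = ty_lat b Y (ty_lat b X Z)"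
  "ty_lat b X X = X"
  "ty_lat b X (ty_lat b X Y) = ty_lat b X Y"
proof -
  interpret semilattice_set "ty_lat b" by (rule semilattice_ty_lat)
  show "ty_lat b (ty_lat b X Y) Z = ty_lat b X (ty_lat b Y Z)" by (rule assoc)
  show "ty_lat b X Y = ty_lat b Y X" by (rule commute)
  show "ty_lat b X (ty_lat b Y Z) = ty_lat b Y (ty_lat b X Z)" by (rule left_commute)
  show "ty_lat b X X = X" by (rule idem)
  show "ty_lat b X (ty_lat b X Y) = ty_lat b X Y" by (rule left_idem)
qed

lemma size_bin: "size (bin b \<sigma> \<tau>) = size \<sigma> + size \<tau> + 1"
  by (simp add: bin_def)

section \<open>Members of the outermost intersection or union\<close>

primrec mems :: "bool \<Rightarrow> ty_expr \<Rightarrow> ty_expr set" where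
  "mems b (Atom n) = {Atom n}"
| "mems b \<omega> = {\<omega>}"
| "mems b (\<sigma> \<rightarrow> \<tau>) = {\<sigma> \<rightarrow> \<tau>}"
| "mems b (\<sigma> \<^bold>\<and> \<tau>) = (if b then mems b \<sigma> \<union> mems b \<tau> else {\<sigma> \<^bold>\<and> \<tau>})"
| "mems b (\<sigma> \<^bold>\<or> \<tau>) = (if b then {\<sigma> \<^bold>\<or> \<tau>} else mems b \<sigma> \<union> mems b \<tau>)"

lemma mems_bin: "mems b (bin b \<sigma> \<tau>) = mems b \<sigma> \<union> mems b \<tau>"
  by (simp add: bin_def)

lemma bin_induct [case_names single bin]:
  assumes "\<And>\<sigma>. mems b \<sigma> = {\<sigma>} \<Longrightarrow> (\<And>\<rho> \<tau>. \<sigma> \<noteq> bin b \<rho> \<tau>) \<Longrightarrow> P \<sigma>"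
    and "\<And>\<sigma> \<tau>. P \<sigma> \<Longrightarrow> P \<tau> \<Longrightarrow> P (bin b \<sigma> \<tau>)"
  shows "P \<sigma>"
proof (induction \<sigma>)
  case (Inter \<sigma> \<tau>)
  then show ?case
    using assms(2)[of \<sigma> \<tau>] assms(1)[of "\<sigma> \<^bold>\<and> \<tau>"] by (cases b) (simp_all add: bin_def)
next
  case (Union \<sigma> \<tau>)
  then show ?case
    using assms(2)[of \<sigma> \<tau>] assms(1)[of "\<sigma> \<^bold>\<or> \<tau>"] by (cases b) (simp_all add: bin_def)
qed (simp_all add: assms(1) bin_def)

lemma mems_nonempty: "mems b \<sigma> \<noteq> {}"
  by (induction \<sigma> rule: bin_induct[of b]) (auto simp: mems_bin)

lemma mems_not_bin: "y \<in> mems b \<sigma> \<Longrightarrow> y \<noteq> bin b \<rho> \<tau>"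
  by (induction \<sigma> rule: bin_induct[of b]) (auto simp: mems_bin)

lemma mems_size: "y \<in> mems b \<sigma> \<Longrightarrow> size y \<le> size \<sigma>"
  by (induction \<sigma> rule: bin_induct[of b]) (auto simp: mems_bin size_bin)

text \<open>Rearrangement without contraction or repetition. It preserves irredundancy, so a step
  from any such rearrangement of an irredundant expression is a step of its type.\<close>

definition same :: "ty_expr \<Rightarrow> ty_expr \<Rightarrow> bool" where
  "same \<sigma> \<tau> \<longleftrightarrow> abs_ty \<sigma> = abs_ty \<tau> \<and> size \<sigma> = size \<tau>"

lemma same_binD:
  assumes "same (bin b \<sigma> \<tau>) \<rho>"
  shows "abs_ty \<rho> = ty_lat b (abs_ty \<sigma>) (abs_ty \<tau>)" "size \<rho> = size \<sigma> + size \<tau> + 1"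
  using assms by (simp_all add: same_def abs_bin size_bin)

text \<open>Associativity and commutativity bring any member to the front at constant size, where a
  rule can meet it.\<close>

lemma mems_pick: "y \<in> mems b \<sigma> \<Longrightarrow> \<sigma> = y \<or> (\<exists>\<rho>. same (bin b y \<rho>) \<sigma>)"
proof (induction \<sigma> rule: bin_induct[of b])
  case (single \<sigma>)
  then show ?case by simp
next
  case (bin \<sigma> \<tau>)
  from bin.prems consider "y \<in> mems b \<sigma>" | "y \<in> mems b \<tau>" by (auto simp: mems_bin)
  then show ?case
  proof cases
    case 1
    with bin.IH(1) consider "\<sigma> = y" | \<rho> where "same (bin b y \<rho>) \<sigma>" by blast
    then show ?thesis
    proof cases
      case 1
      then show ?thesis by (auto simp: same_def)
    next
      case 2
      then have "same (bin b y (bin b \<rho> \<tau>)) (bin b \<sigma> \<tau>)"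
        using same_binD[OF 2] by (simp add: same_def abs_bin size_bin ty_lat_ac(1))
      then show ?thesis by blast
    qed
  next
    case 2
    with bin.IH(2) consider "\<tau> = y" | \<rho> where "same (bin b y \<rho>) \<tau>" by blast
    then show ?thesis
    proof cases
      case 1
      then have "same (bin b y \<sigma>) (bin b \<sigma> \<tau>)" by (simp add: same_def abs_bin size_bin ty_lat_ac(2))
      then show ?thesis by blast
    next
      case 2
      then have "same (bin b y (bin b \<sigma> \<rho>)) (bin b \<sigma> \<tau>)"
        using same_binD[OF 2] by (simp add: same_def abs_bin size_bin ty_lat_ac(3))
      then show ?thesis by blast
    qed
  qed
qed

section \<open>Contexts and expressions irreducible by inner rules\<close>

primrec comp :: "ctxt \<Rightarrow> ctxt \<Rightarrow> ctxt" where
  "comp Hole D = D"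
| "comp (CArrow1 C \<sigma>) D = CArrow1 (comp C D) \<sigma>"
| "comp (CArrow2 \<sigma> C) D = CArrow2 \<sigma> (comp C D)"
| "comp (CInter1 \<sigma> C) D = CInter1 \<sigma> (comp C D)"
| "comp (CInter2 C \<sigma>) D = CInter2 (comp C D) \<sigma>"
| "comp (CUnion1 \<sigma> C) D = CUnion1 \<sigma> (comp C D)"
| "comp (CUnion2 C \<sigma>) D = CUnion2 (comp C D) \<sigma>"

lemma fill_comp: "fill (comp C D) \<sigma> = fill C (fill D \<sigma>)"
  by (induction C) auto

lemma aci_fill: "\<sigma> \<approx> \<tau> \<Longrightarrow> fill C \<sigma> \<approx> fill C \<tau>"
  by (induction C) (auto intro: aci.refl aci.cong_arrow aci.cong_inter aci.cong_union)

lemma size_fill: "size (fill C \<sigma>) + size \<tau> = size (fill C \<tau>) + size \<sigma>"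
  by (induction C) auto

lemma irredundant_fill: "irredundant (fill C \<sigma>) \<Longrightarrow> irredundant \<sigma>"
  unfolding irredundant_def
proof (intro allI impI)
  fix \<tau> assume *: "\<forall>\<tau>. fill C \<sigma> \<approx> \<tau> \<longrightarrow> size (fill C \<sigma>) \<le> size \<tau>" and "\<sigma> \<approx> \<tau>"
  then have "size (fill C \<sigma>) \<le> size (fill C \<tau>)" using aci_fill by blast
  then show "size \<sigma> \<le> size \<tau>" using size_fill[of C \<sigma> \<tau>] by linarith
qed

lemma same_fill: "same \<sigma> \<tau> \<Longrightarrow> same (fill C \<sigma>) (fill C \<tau>)"
  using aci_fill[of \<sigma> \<tau> C] size_fill[of C \<sigma> \<tau>] by (simp add: same_def aci_iff)

definition inner_irred :: "ty_expr \<Rightarrow> bool" where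
  "inner_irred \<sigma> \<longleftrightarrow> irredundant \<sigma> \<and> (\<forall>C \<rho> \<rho>'. same (fill C \<rho>) \<sigma> \<longrightarrow> \<not> \<rho> \<leadsto> \<rho>')"

lemma inner_irredD: "inner_irred \<sigma> \<Longrightarrow> same (fill C \<rho>) \<sigma> \<Longrightarrow> \<rho> \<leadsto> \<rho>' \<Longrightarrow> False"
  by (auto simp: inner_irred_def)

lemma inner_irred_fill: "inner_irred (fill C \<sigma>) \<Longrightarrow> inner_irred \<sigma>"
  unfolding inner_irred_def by (metis fill_comp irredundant_fill same_fill)

lemma inner_irred_arrow: "inner_irred (\<sigma> \<rightarrow> \<tau>) \<Longrightarrow> inner_irred \<sigma> \<and> inner_irred \<tau>"
  using inner_irred_fill[of "CArrow1 Hole \<tau>" \<sigma>] inner_irred_fill[of "CArrow2 \<sigma> Hole" \<tau>] by simp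

lemma inner_irred_bin: "inner_irred (bin b \<sigma> \<tau>) \<Longrightarrow> inner_irred \<sigma> \<and> inner_irred \<tau>"
  using inner_irred_fill[of "CInter2 Hole \<tau>" \<sigma>] inner_irred_fill[of "CInter1 \<sigma> Hole" \<tau>]
    inner_irred_fill[of "CUnion2 Hole \<tau>" \<sigma>] inner_irred_fill[of "CUnion1 \<sigma> Hole" \<tau>]
  by (cases b) (simp_all add: bin_def)

lemma inner_irred_mems: "inner_irred \<sigma> \<Longrightarrow> y \<in> mems b \<sigma> \<Longrightarrow> inner_irred y"
  by (induction \<sigma> rule: bin_induct[of b]) (auto simp: mems_bin dest: inner_irred_bin)

lemma erase_bin: "\<sigma> \<preceq> \<tau> \<or> \<tau> \<preceq> \<sigma> \<Longrightarrow> \<exists>\<rho> \<zeta>. same \<rho> (bin b \<sigma> \<tau>) \<and> \<rho> \<leadsto> \<zeta>"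
proof -
  have s: "same (bin b \<sigma> \<tau>) (bin b \<sigma> \<tau>)" "same (bin b \<tau> \<sigma>) (bin b \<sigma> \<tau>)"
    by (simp_all add: same_def abs_bin size_bin ty_lat_ac(2))
  have "\<exists>\<zeta>. bin b \<rho> \<rho>' \<leadsto> \<zeta>" if "\<rho> \<preceq> \<rho>'" for \<rho> \<rho>'
    using that by (cases b) (auto simp: bin_def intro: erase_inter erase_union)
  moreover assume "\<sigma> \<preceq> \<tau> \<or> \<tau> \<preceq> \<sigma>"
  ultimately show ?thesis using s by blast
qed

lemma mems_pick2:
  assumes "y \<in> mems b \<sigma>" "z \<in> mems b \<tau>"
  shows "\<exists>C. same (fill C (bin b y z)) (bin b \<sigma> \<tau>)"
proof -
  let ?C = "\<lambda>\<rho>. if b then CInter2 Hole \<rho> else CUnion2 Hole \<rho>"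
  have C: "fill (?C \<rho>) \<zeta> = bin b \<zeta> \<rho>" for \<rho> \<zeta> by (simp add: bin_def)
  from mems_pick[OF assms(1)] mems_pick[OF assms(2)]
  consider "\<sigma> = y" "\<tau> = z" | \<rho> where "same (bin b y \<rho>) \<sigma>" "\<tau> = z"
    | \<rho>' where "\<sigma> = y" "same (bin b z \<rho>') \<tau>"
    | \<rho> \<rho>' where "same (bin b y \<rho>) \<sigma>" "same (bin b z \<rho>') \<tau>" by blast
  then show ?thesis
  proof cases
    case 1
    then show ?thesis by (intro exI[of _ Hole]) (simp add: same_def)
  next
    case (2 \<rho>)
    then show ?thesis using same_binD[OF 2(1)]
      by (intro exI[of _ "?C \<rho>"], unfold C) (simp add: same_def abs_bin size_bin ty_lat_ac(1-3))
  next
    case (3 \<rho>')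
    then show ?thesis using same_binD[OF 3(2)]
      by (intro exI[of _ "?C \<rho>'"], unfold C) (simp add: same_def abs_bin size_bin ty_lat_ac(1-3))
  next
    case (4 \<rho> \<rho>')
    then show ?thesis using same_binD[OF 4(1)] same_binD[OF 4(2)]
      by (intro exI[of _ "?C (bin b \<rho> \<rho>')"], unfold C) (simp add: same_def abs_bin size_bin ty_lat_ac(1-3))
  qed
qed

text \<open>Two comparable members from the two sides could be moved next to each other, and one of
  them erased.\<close>

lemma inner_irred_incomparable:
  assumes "inner_irred (bin b \<sigma> \<tau>)" "y \<in> mems b \<sigma>" "z \<in> mems b \<tau>"
  shows "\<not> y \<preceq> z \<and> \<not> z \<preceq> y"
proof (rule ccontr)
  assume "\<not> (\<not> y \<preceq> z \<and> \<not> z \<preceq> y)"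
  then obtain \<rho> \<zeta> where \<rho>: "same \<rho> (bin b y z)" "\<rho> \<leadsto> \<zeta>" using erase_bin[of y z b] by blast
  obtain C where "same (fill C (bin b y z)) (bin b \<sigma> \<tau>)" using mems_pick2[OF assms(2,3)] by blast
  then have "same (fill C \<rho>) (bin b \<sigma> \<tau>)" using same_fill[OF \<rho>(1), of C] by (simp add: same_def)
  then show False using inner_irredD[OF assms(1)] \<rho>(2) by blast
qed

text \<open>As the greatest type, \<open>\<omega>\<close> would be comparable with any member on the
  other side.\<close>

lemma omega_notin_mems: "inner_irred \<sigma> \<Longrightarrow> \<sigma> \<noteq> \<omega> \<Longrightarrow> \<omega> \<notin> mems b \<sigma>"
proof (induction \<sigma> rule: bin_induct[of b])
  case (bin \<sigma> \<tau>)
  obtain y z where "y \<in> mems b \<sigma>" "z \<in> mems b \<tau>" using mems_nonempty by blast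
  then show ?case using inner_irred_incomparable[OF bin.prems(1)] le_omega by (auto simp: mems_bin)
qed auto

text \<open>A union that is the whole argument is a redex of \<open>union_arrow\<close>; one that is
  a proper member of an intersection is a redex of \<open>distr_left\<close>.\<close>

lemma mems_union_in_arrow:
  assumes "inner_irred (\<sigma> \<rightarrow> \<tau>)" "y \<in> mems True \<sigma>"
  shows "y \<noteq> u \<^bold>\<or> v"
proof
  assume y: "y = u \<^bold>\<or> v"
  from mems_pick[OF assms(2)] consider "\<sigma> = y" | \<rho> where "same (y \<^bold>\<and> \<rho>) \<sigma>" by (auto simp: bin_def)
  then show False
  proof cases
    case 1
    have "same (fill Hole (\<sigma> \<rightarrow> \<tau>)) (\<sigma> \<rightarrow> \<tau>)" by (simp add: same_def)
    then show False using inner_irredD[OF assms(1)] union_arrow 1 y by blast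
  next
    case (2 \<rho>)
    then have "same (fill Hole (y \<^bold>\<and> \<rho> \<rightarrow> \<tau>)) (\<sigma> \<rightarrow> \<tau>)" by (simp add: same_def abs_arrow)
    then show False using inner_irredD[OF assms(1)] distr_left y by blast
  qed
qed

text \<open>Dually, the redexes are those of \<open>arrow_inter\<close> and
  \<open>distr_right\<close>.\<close>

lemma mems_inter_in_arrow:
  assumes "inner_irred (\<sigma> \<rightarrow> \<tau>)" "y \<in> mems False \<tau>"
  shows "y \<noteq> u \<^bold>\<and> v"
proof
  assume y: "y = u \<^bold>\<and> v"
  from mems_pick[OF assms(2)] consider "\<tau> = y" | \<rho> where "same (y \<^bold>\<or> \<rho>) \<tau>" by (auto simp: bin_def)
  then show False
  proof cases
    case 1
    have "same (fill Hole (\<sigma> \<rightarrow> \<tau>)) (\<sigma> \<rightarrow> \<tau>)" by (simp add: same_def)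
    then show False using inner_irredD[OF assms(1)] arrow_inter 1 y by blast
  next
    case (2 \<rho>)
    then have "same (fill Hole (\<sigma> \<rightarrow> y \<^bold>\<or> \<rho>)) (\<sigma> \<rightarrow> \<tau>)" by (simp add: same_def abs_arrow)
    then show False using inner_irredD[OF assms(1)] distr_right y by blast
  qed
qed

text \<open>\<open>big False []\<close> is a junk value, since there is no empty union.\<close>

fun big :: "bool \<Rightarrow> ty_expr list \<Rightarrow> ty_expr" where
  "big b [] = \<omega>"
| "big b [x] = x"
| "big b (x # xs) = bin b x (big b xs)"

lemma big_Cons: "xs \<noteq> [] \<Longrightarrow> big b (x # xs) = bin b x (big b xs)"
  by (cases xs) auto

lemma abs_big_append:
  "xs \<noteq> [] \<Longrightarrow> ys \<noteq> [] \<Longrightarrow> abs_ty (big b (xs @ ys)) = abs_ty (bin b (big b xs) (big b ys))"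
proof (induction xs rule: list_nonempty_induct)
  case (cons x xs)
  then show ?case by (simp add: big_Cons abs_bin ty_lat_ac(1))
qed (simp add: big_Cons)

lemma big_absorb: "x \<approx> y \<Longrightarrow> y \<in> set ys \<Longrightarrow> abs_ty (bin b x (big b ys)) = abs_ty (big b ys)"
proof (induction ys rule: induct_list012)
  case (3 z z' zs)
  have e: "big b (z # z' # zs) = bin b z (big b (z' # zs))" by simp
  show ?case
  proof (cases "y = z")
    case True
    then show ?thesis unfolding e using 3(3) by (simp add: aci_iff abs_bin ty_lat_ac(5))
  next
    case False
    then have "abs_ty (bin b x (big b (z' # zs))) = abs_ty (big b (z' # zs))" using 3 by auto
    then show ?thesis unfolding e abs_bin by (metis ty_lat_ac(3))
  qed
qed (auto simp: aci_iff abs_bin ty_lat_ac(4))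

lemma big_subset:
  "xs \<noteq> [] \<Longrightarrow> (\<And>x. x \<in> set xs \<Longrightarrow> \<exists>y\<in>set ys. x \<approx> y) \<Longrightarrow>
    abs_ty (bin b (big b xs) (big b ys)) = abs_ty (big b ys)"
proof (induction xs rule: list_nonempty_induct)
  case (single x)
  then show ?case using big_absorb by fastforce
next
  case (cons x xs)
  have "abs_ty (bin b (big b xs) (big b ys)) = abs_ty (big b ys)" using cons by simp
  moreover have "abs_ty (bin b x (big b ys)) = abs_ty (big b ys)"
    using cons.prems[of x] big_absorb by auto
  ultimately show ?case using cons.hyps by (simp add: big_Cons abs_bin ty_lat_ac(1))
qed

text \<open>Each side absorbs the other by idempotence, and by commutativity the two absorptions
  have the same value.\<close>

lemma big_cong:
  assumes "\<And>x. x \<in> set xs \<Longrightarrow> \<exists>y\<in>set ys. x \<approx> y" "\<And>y. y \<in> set ys \<Longrightarrow> \<exists>x\<in>set xs. y \<approx> x"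
  shows "big b xs \<approx> big b ys"
proof (cases "xs = [] \<or> ys = []")
  case True
  then have "xs = []" "ys = []" using assms by (cases xs; cases ys; auto)+
  then show ?thesis by (simp add: aci.refl)
next
  case False
  then have "abs_ty (bin b (big b xs) (big b ys)) = abs_ty (big b ys)"
    "abs_ty (bin b (big b ys) (big b xs)) = abs_ty (big b xs)"
    using assms by (auto intro!: big_subset)
  then show ?thesis by (simp add: aci_iff abs_bin ty_lat_ac(2))
qed

section \<open>Reading elements back as types, and uniqueness for antichains\<close>

primrec ty_of_el :: "el \<Rightarrow> ty_expr" where
  "ty_of_el (At n) = Atom n"
| "ty_of_el (Ar A B) = (big True (map ty_of_el A) \<rightarrow> big False (map ty_of_el B))"

definition antichain :: "('a \<Rightarrow> 'a \<Rightarrow> bool) \<Rightarrow> 'a set \<Rightarrow> bool" where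
  "antichain R X \<longleftrightarrow> (\<forall>x\<in>X. \<forall>y\<in>X. R x y \<longrightarrow> x = y)"

text \<open>Going from \<open>x\<close> up into \<open>Y\<close> and from there up into
  \<open>X\<close> must lead back to \<open>x\<close>, so the intermediate element is equivalent to
  \<open>x\<close>. The primed variant goes down instead.\<close>

lemma antichain_match:
  assumes "transp R" "antichain R X"
    and "\<And>x. x \<in> X \<Longrightarrow> \<exists>y\<in>Y. R x y" "\<And>y. y \<in> Y \<Longrightarrow> \<exists>x\<in>X. R y x"
    and "x \<in> X"
  shows "\<exists>y\<in>Y. R x y \<and> R y x"
  using assms unfolding antichain_def by (metis transpD)

lemma antichain_match':
  assumes "transp R" "antichain R X"
    and "\<And>x. x \<in> X \<Longrightarrow> \<exists>y\<in>Y. R y x" "\<And>y. y \<in> Y \<Longrightarrow> \<exists>x\<in>X. R x y"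
    and "x \<in> X"
  shows "\<exists>y\<in>Y. R x y \<and> R y x"
  using assms unfolding antichain_def by (metis transpD)

lemma transp_el_le: "transp el_le" and transp_clause_le: "transp clause_le"
  by (auto intro!: transpI intro: el_le_trans clause_le_trans)

inductive normal :: "el \<Rightarrow> bool" where
  "normal (At n)"
| "(\<And>a. a \<in> set A \<Longrightarrow> normal a) \<Longrightarrow> (\<And>b. b \<in> set B \<Longrightarrow> normal b) \<Longrightarrow>
    antichain el_le (set A) \<Longrightarrow> antichain el_le (set B) \<Longrightarrow> B \<noteq> [] \<Longrightarrow> normal (Ar A B)"

inductive_cases normal_ArE: "normal (Ar A B)"

lemma big_True_le: "y \<in> set ys \<Longrightarrow> big True ys \<preceq> y"
  by (induction ys rule: induct_list012)
    (auto simp: bin_def intro: norm_le.intros)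

lemma le_big_True: "(\<And>y. y \<in> set ys \<Longrightarrow> x \<preceq> y) \<Longrightarrow> x \<preceq> big True ys"
  by (induction ys rule: induct_list012) (auto simp: bin_def intro: norm_le.intros)

lemma le_big_False: "y \<in> set ys \<Longrightarrow> y \<preceq> big False ys"
  by (induction ys rule: induct_list012) (auto simp: bin_def intro: norm_le.intros)

lemma big_False_le: "ys \<noteq> [] \<Longrightarrow> (\<And>y. y \<in> set ys \<Longrightarrow> y \<preceq> x) \<Longrightarrow> big False ys \<preceq> x"
  by (induction ys rule: induct_list012) (auto simp: bin_def intro: norm_le.intros)

text \<open>A converse to soundness: comparable elements of an irreducible type give comparable
  members, hence an erasure. Normality keeps clauses nonempty; \<open>big False\<close> would turn
  an empty one into \<open>\<omega>\<close>.\<close>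

lemma el_le_imp_norm_le: "normal e \<Longrightarrow> normal e' \<Longrightarrow> el_le e e' \<Longrightarrow> ty_of_el e \<preceq> ty_of_el e'"
proof (induction e e' rule: el_le.induct)
  case (1 m n)
  then show ?case by (simp add: le_refl)
next
  case (2 m A B)
  then obtain b where b: "b \<in> set B" "el_le (At m) b" by auto
  have "normal b" using 2(3) b(1) by (auto elim: normal_ArE)
  then have "Atom m \<preceq> ty_of_el b" using 2(1)[OF b(1)] 2(2) b by simp
  also have "ty_of_el b \<preceq> big False (map ty_of_el B)" using b by (intro le_big_False) auto
  \<comment> \<open>The chain goes through \<open>\<rho> \<rightarrow> Atom m\<close>, where
    \<open>\<rho>\<close> is the argument of the arrow: first \<open>atom_le\<close>, then
    monotonicity in the result.\<close>
  finally (le_trans) show ?case using atom_le arrow_mono le_refl le_trans by (metis ty_of_el.simps)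
next
  case (3 A B n)
  then show ?case by simp
next
  case (4 A B A' B')
  have n: "normal a" if "a \<in> set A \<union> set B \<union> set A' \<union> set B'" for a
    using 4(3,4) that by (auto elim!: normal_ArE)
  have ne: "B \<noteq> []" using 4(3) by (auto elim: normal_ArE)
  have "big True (map ty_of_el A') \<preceq> big True (map ty_of_el A)"
  proof (rule le_big_True)
    fix y assume "y \<in> set (map ty_of_el A)"
    then obtain a where a: "a \<in> set A" "y = ty_of_el a" by auto
    then obtain a' where a': "a' \<in> set A'" "el_le a' a" using 4(5) by auto
    have "ty_of_el a' \<preceq> y" using 4(1)[OF a(1) a'(1)] n a a' by simp
    then show "big True (map ty_of_el A') \<preceq> y"
      using big_True_le[of "ty_of_el a'" "map ty_of_el A'"] a' by (auto intro: le_trans)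
  qed
  moreover have "big False (map ty_of_el B) \<preceq> big False (map ty_of_el B')"
  proof (rule big_False_le)
    fix y assume "y \<in> set (map ty_of_el B)"
    then obtain b where b: "b \<in> set B" "y = ty_of_el b" by auto
    then obtain b' where b': "b' \<in> set B'" "el_le b b'" using 4(5) by auto
    have "y \<preceq> ty_of_el b'" using 4(2)[OF b(1) b'(1)] n b b' by simp
    then show "y \<preceq> big False (map ty_of_el B')"
      using le_big_False[of "ty_of_el b'" "map ty_of_el B'"] b' by (auto intro: le_trans)
  qed (use ne in simp)
  ultimately show ?case by (simp add: arrow_mono)
qed

text \<open>Mutually dominating antichains match element by element, and \<open>big\<close> depends
  only on the members up to \<open>\<approx>\<close>. The last premise leaves room for an induction
  hypothesis, and the flag \<open>p\<close> for the reuse with cubes.\<close>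

lemma clause_unique:
  assumes "antichain el_le (set B)" "antichain el_le (set B')" "clause_le B B'" "clause_le B' B"
    and "\<And>b b'. b \<in> set B \<Longrightarrow> b' \<in> set B' \<Longrightarrow> el_le b b' \<Longrightarrow> el_le b' b \<Longrightarrow> ty_of_el b \<approx> ty_of_el b'"
  shows "big p (map ty_of_el B) \<approx> big p (map ty_of_el B')"
proof (rule big_cong)
  fix x assume "x \<in> set (map ty_of_el B)"
  then obtain b where b: "b \<in> set B" "x = ty_of_el b" by auto
  then have "\<exists>b'\<in>set B'. el_le b b' \<and> el_le b' b"
    using assms(3,4) by (intro antichain_match[OF transp_el_le assms(1)]) (auto simp: clause_le_def)
  then show "\<exists>y\<in>set (map ty_of_el B'). x \<approx> y" using assms(5) b by auto
next
  fix x assume "x \<in> set (map ty_of_el B')"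
  then obtain b where b: "b \<in> set B'" "x = ty_of_el b" by auto
  then have "\<exists>b'\<in>set B. el_le b b' \<and> el_le b' b"
    using assms(3,4) by (intro antichain_match[OF transp_el_le assms(2)]) (auto simp: clause_le_def)
  then show "\<exists>y\<in>set (map ty_of_el B). x \<approx> y" using assms(5) b aci.sym by auto blast
qed

text \<open>Between antichains, mutual comparison as cubes also yields a matching, and a matching is
  a mutual comparison as clauses.\<close>

lemma cube_unique:
  assumes "antichain el_le (set A)" "antichain el_le (set A')" "cube_le A A'" "cube_le A' A"
    and "\<And>a a'. a \<in> set A \<Longrightarrow> a' \<in> set A' \<Longrightarrow> el_le a a' \<Longrightarrow> el_le a' a \<Longrightarrow> ty_of_el a \<approx> ty_of_el a'"
  shows "big p (map ty_of_el A) \<approx> big p (map ty_of_el A')"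
proof (rule clause_unique[OF assms(1,2) _ _ assms(5)])
  have "\<exists>b\<in>set A'. el_le a b \<and> el_le b a" if "a \<in> set A" for a
    using assms(3,4) that by (intro antichain_match'[OF transp_el_le assms(1)]) (auto simp: cube_le_def)
  then show "clause_le A A'" by (auto simp: clause_le_def)
  have "\<exists>b\<in>set A. el_le a b \<and> el_le b a" if "a \<in> set A'" for a
    using assms(3,4) that by (intro antichain_match'[OF transp_el_le assms(2)]) (auto simp: cube_le_def)
  then show "clause_le A' A" by (auto simp: clause_le_def)
qed

lemma el_unique:
  "normal e \<Longrightarrow> normal e' \<Longrightarrow> el_le e e' \<Longrightarrow> el_le e' e \<Longrightarrow> ty_of_el e \<approx> ty_of_el e'"
proof (induction arbitrary: e' rule: normal.induct)
  case (1 n)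
  then show ?case by (cases e') (auto intro: aci.refl)
next
  case (2 A B)
  obtain A' B' where e': "e' = Ar A' B'" using "2.prems" by (cases e') auto
  have n: "\<And>a. a \<in> set A' \<Longrightarrow> normal a" "\<And>b. b \<in> set B' \<Longrightarrow> normal b"
    "antichain el_le (set A')" "antichain el_le (set B')"
    using "2.prems"(1) unfolding e' by (auto elim: normal_ArE)
  have "big True (map ty_of_el A) \<approx> big True (map ty_of_el A')"
    by (rule cube_unique[OF \<open>antichain el_le (set A)\<close> n(3)])
      (use "2.IH" "2.prems" n e' in \<open>auto simp: cube_le_def\<close>)
  moreover have "big False (map ty_of_el B) \<approx> big False (map ty_of_el B')"
    by (rule clause_unique[OF \<open>antichain el_le (set B)\<close> n(4)])
      (use "2.IH" "2.prems" n e' in \<open>auto simp: clause_le_def\<close>)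
  ultimately show ?case by (simp add: e' aci.cong_arrow)
qed

section \<open>Irreducible expressions as elements, cubes and clauses\<close>

definition is_el :: "ty_expr \<Rightarrow> bool" where
  "is_el \<sigma> \<longleftrightarrow> (\<exists>e. (\<forall>p. nf p \<sigma> = [[e]]) \<and> normal e \<and> ty_of_el e \<approx> \<sigma>)"

text \<open>The negated flag is deliberate: a union of elements is a single entry of
  \<open>cnf\<close>, an intersection of elements a single entry of \<open>dnf\<close>.\<close>

definition reads :: "bool \<Rightarrow> ty_expr \<Rightarrow> el list \<Rightarrow> bool" where
  "reads b \<sigma> A \<longleftrightarrow> nf (\<not> b) \<sigma> = [A] \<and> A \<noteq> [] \<and> antichain el_le (set A) \<and>
    (\<forall>a\<in>set A. normal a) \<and> big b (map ty_of_el A) \<approx> \<sigma>"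

lemma nf_bin: "nf (\<not> b) \<sigma> = [A] \<Longrightarrow> nf (\<not> b) \<tau> = [A'] \<Longrightarrow> nf (\<not> b) (bin b \<sigma> \<tau>) = [A @ A']"
  by (cases b) (simp_all add: bin_def)

lemma aci_norm_le: "\<sigma>' \<approx> \<sigma> \<Longrightarrow> \<tau>' \<approx> \<tau> \<Longrightarrow> \<sigma>' \<preceq> \<tau>' \<Longrightarrow> \<sigma> \<preceq> \<tau>"
  using aci_imp_le le_trans by meson

lemma antichain_Un:
  assumes "antichain R X" "antichain R Y" "\<And>x y. x \<in> X \<Longrightarrow> y \<in> Y \<Longrightarrow> \<not> R x y \<and> \<not> R y x"
  shows "antichain R (X \<union> Y)"
  using assms unfolding antichain_def by blast

text \<open>Concatenation keeps an antichain because elements of the two lists correspond to members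
  of the two operands, which irreducibility makes incomparable. The second conjunct records this
  correspondence for the induction.\<close>

lemma reads_exists:
  assumes "inner_irred \<sigma>" "\<And>y. y \<in> mems b \<sigma> \<Longrightarrow> is_el y"
  shows "\<exists>A. reads b \<sigma> A \<and> (\<forall>a\<in>set A. \<exists>y\<in>mems b \<sigma>. ty_of_el a \<approx> y)"
  using assms
proof (induction \<sigma> rule: bin_induct[of b])
  case (single \<sigma>)
  then obtain e where "nf (\<not> b) \<sigma> = [[e]]" "normal e" "ty_of_el e \<approx> \<sigma>" unfolding is_el_def by auto
  then show ?case using single(1) by (intro exI[of _ "[e]"]) (auto simp: reads_def antichain_def)
next
  case (bin \<sigma> \<tau>)
  obtain A where A: "reads b \<sigma> A" "\<And>a. a \<in> set A \<Longrightarrow> \<exists>y\<in>mems b \<sigma>. ty_of_el a \<approx> y"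
    using bin inner_irred_bin by (metis UnI1 mems_bin)
  obtain A' where A': "reads b \<tau> A'" "\<And>a. a \<in> set A' \<Longrightarrow> \<exists>y\<in>mems b \<tau>. ty_of_el a \<approx> y"
    using bin inner_irred_bin by (metis UnI2 mems_bin)
  have "antichain el_le (set A \<union> set A')"
  proof (rule antichain_Un)
    fix a a' assume a: "a \<in> set A" and a': "a' \<in> set A'"
    obtain y where y: "y \<in> mems b \<sigma>" "ty_of_el a \<approx> y" using A(2) a by blast
    obtain y' where y': "y' \<in> mems b \<tau>" "ty_of_el a' \<approx> y'" using A'(2) a' by blast
    have n: "normal a" "normal a'" using A A' a a' by (auto simp: reads_def)
    show "\<not> el_le a a' \<and> \<not> el_le a' a"
      using inner_irred_incomparable[OF bin.prems(1) y(1) y'(1)] el_le_imp_norm_le n y y' aci_norm_le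
      by metis
  qed (use A A' in \<open>auto simp: reads_def\<close>)
  moreover have "nf (\<not> b) (bin b \<sigma> \<tau>) = [A @ A']"
    using A A' by (intro nf_bin) (auto simp: reads_def)
  moreover have "big b (map ty_of_el (A @ A')) \<approx> bin b \<sigma> \<tau>"
    using A(1) A'(1) by (simp add: reads_def aci_iff abs_big_append abs_bin)
  ultimately have "reads b (bin b \<sigma> \<tau>) (A @ A')" using A(1) A'(1) by (auto simp: reads_def)
  then show ?case using A(2) A'(2) by (intro exI[of _ "A @ A'"]) (auto simp: mems_bin)
qed

lemma mems_not_lat:
  "y \<in> mems True \<sigma> \<Longrightarrow> y \<noteq> u \<^bold>\<and> v" "y \<in> mems False \<sigma> \<Longrightarrow> y \<noteq> u \<^bold>\<or> v"
  using mems_not_bin[of y True \<sigma> u v] mems_not_bin[of y False \<sigma> u v] by (simp_all add: bin_def)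

lemma irredundant_omega: "irredundant \<sigma> \<Longrightarrow> \<sigma> \<approx> \<omega> \<Longrightarrow> size \<sigma> = 0"
  by (force simp: irredundant_def)

text \<open>In an irreducible arrow no member of the argument is a union and no member of the result
  an intersection. The members are thus smaller atoms or arrows, \<open>\<omega>\<close> apart, and
  the induction reaches them.\<close>

lemma inner_irred_is_el:
  assumes "inner_irred \<sigma>" "\<sigma> \<noteq> \<omega>" "\<And>u v. \<sigma> \<noteq> u \<^bold>\<and> v" "\<And>u v. \<sigma> \<noteq> u \<^bold>\<or> v"
  shows "is_el \<sigma>"
  using assms
proof (induction "size \<sigma>" arbitrary: \<sigma> rule: less_induct)
  case less
  show ?case
  proof (cases \<sigma>)
    case (Atom n)
    then show ?thesis
      unfolding is_el_def by (intro exI[of _ "At n"]) (auto intro: normal.intros aci.refl)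
  next
    case (Arrow \<rho> \<tau>)
    note irr = less.prems(1)[unfolded Arrow]
    have refl: "same (fill Hole (\<rho> \<rightarrow> \<tau>)) (\<rho> \<rightarrow> \<tau>)" by (simp add: same_def)
    have \<tau>: "\<tau> \<noteq> \<omega>"
    proof
      assume "\<tau> = \<omega>"
      \<comment> \<open>Were the arrow equal to \<open>\<omega>\<close> as a type, irredundancy
        would force size 0. So \<open>to_omega\<close> is applicable.\<close>
      have "\<not> (\<rho> \<rightarrow> \<omega>) \<approx> \<omega>" using irr irredundant_omega \<open>\<tau> = \<omega>\<close> by (fastforce simp: inner_irred_def)
      then have "(\<rho> \<rightarrow> \<tau>) \<leadsto> \<omega>" using \<open>\<tau> = \<omega>\<close> by (simp add: to_omega omega_le)
      then show False using inner_irredD[OF irr refl] by blast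
    qed
    have "is_el y" if y: "y \<in> mems False \<tau>" for y
      using y mems_size[OF y] Arrow inner_irred_mems[of \<tau>, OF _ y] inner_irred_arrow[OF irr]
        omega_notin_mems[OF _ \<tau>] mems_inter_in_arrow[OF irr y] mems_not_lat(2)[OF y]
      by (intro less.hyps) auto
    then obtain B where B: "reads False \<tau> B"
      using reads_exists inner_irred_arrow[OF irr] by blast
    obtain A where A: "dnf \<rho> = [A]" "antichain el_le (set A)" "\<forall>a\<in>set A. normal a"
      "big True (map ty_of_el A) \<approx> \<rho>" "A = [] \<longrightarrow> \<rho> = \<omega>"
    proof (cases "\<rho> = \<omega>")
      case True
      \<comment> \<open>The empty cube represents \<open>\<omega>\<close>, matching the value of
        \<open>big True []\<close>.\<close>
      then show ?thesis using that[of "[]"] by (simp add: antichain_def aci.refl)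
    next
      case False
      have "is_el y" if y: "y \<in> mems True \<rho>" for y
        using y mems_size[OF y] Arrow inner_irred_mems[of \<rho>, OF _ y] inner_irred_arrow[OF irr]
          omega_notin_mems[OF _ False] mems_union_in_arrow[OF irr y] mems_not_lat(1)[OF y]
        by (intro less.hyps) auto
      then obtain A where "reads True \<rho> A"
        using reads_exists inner_irred_arrow[OF irr] by blast
      then show ?thesis using that[of A] by (simp add: reads_def)
    qed
    have "\<not> (A = [] \<and> (\<exists>n. const_clause n B))"
    proof
      assume "A = [] \<and> (\<exists>n. const_clause n B)"
      then obtain n where n: "\<rho> = \<omega>" "const_clause n B" using A by blast
      \<comment> \<open>The constant clause may repeat its atom, which \<open>\<approx>\<close>
        contracts. Irredundancy of \<open>\<tau>\<close> then supplies the equal size that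
        \<open>same\<close> requires for the redex of \<open>omega_arrow\<close>.\<close>
      then have "big False (map ty_of_el B) \<approx> big False [Atom n]"
        by (intro big_cong) (auto simp: const_clause_def aci.refl neq_Nil_conv)
      then have aci: "abs_ty \<tau> = abs_ty (Atom n)" using B by (simp add: reads_def aci_iff)
      then have "size \<tau> = size (Atom n)"
        using inner_irred_arrow[OF irr] by (auto simp: inner_irred_def irredundant_def aci_iff)
      then have "same (fill Hole (\<omega> \<rightarrow> Atom n)) (\<rho> \<rightarrow> \<tau>)" using n aci by (simp add: same_def abs_arrow)
      then show False using inner_irredD[OF irr] omega_arrow by blast
    qed
    then have arr: "arr A B = Ar A B" unfolding arr_def by (rule if_not_P)
    have "nf p \<sigma> = [[Ar A B]]" for p
      using A(1) B arr unfolding Arrow nf_arrow arrows_def by (simp add: reads_def)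
    moreover have "normal (Ar A B)" using A B by (intro normal.intros) (auto simp: reads_def)
    moreover have "ty_of_el (Ar A B) \<approx> \<sigma>" using A B unfolding Arrow by (simp add: reads_def aci.cong_arrow)
    ultimately show ?thesis unfolding is_el_def by blast
  qed (use less.prems in auto)
qed

section \<open>Irreducible types and their clauses\<close>

definition top_irred :: "ty_expr \<Rightarrow> bool" where
  "top_irred \<sigma> \<longleftrightarrow> irredundant \<sigma> \<and> (\<forall>\<rho> \<rho>'. same \<rho> \<sigma> \<longrightarrow> \<not> top_step \<rho> \<rho>')"

lemma top_irred_inner: "top_irred \<sigma> \<Longrightarrow> inner_irred \<sigma>"
  unfolding top_irred_def inner_irred_def using top_step.inner by blast

text \<open>An intersection inside a union that is a member of the outermost intersection would be a
  redex of \<open>distr\<close>, so only atoms and arrows occur there.\<close>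

lemma top_irred_clause:
  assumes irr: "top_irred \<sigma>" and ne: "\<sigma> \<noteq> \<omega>" and y: "y \<in> mems True \<sigma>"
  shows "\<exists>B. reads False y B"
proof -
  have y_irr: "inner_irred y" using inner_irred_mems[OF top_irred_inner[OF irr] y] .
  have y_ne: "y \<noteq> \<omega>" using omega_notin_mems[OF top_irred_inner[OF irr] ne, of True] y by blast
  have "is_el z" if z: "z \<in> mems False y" for z
  proof (rule inner_irred_is_el)
    show "inner_irred z" using inner_irred_mems[OF y_irr z] .
    show "z \<noteq> \<omega>" using omega_notin_mems[OF y_irr y_ne, of False] z by blast
    fix u v
    show "z \<noteq> u \<^bold>\<or> v" using mems_not_lat(2)[OF z] .
    show "z \<noteq> u \<^bold>\<and> v"
    proof
      assume uv: "z = u \<^bold>\<and> v"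
      \<comment> \<open>The intersection \<open>z\<close> is not all of \<open>y\<close>, since a
        member of an intersection is not itself one; hence it has a partner \<open>\<rho>\<close> in
        the union.\<close>
      then obtain \<rho> where \<rho>: "same (z \<^bold>\<or> \<rho>) y"
        using mems_pick[OF z] mems_not_lat(1)[OF y] by (auto simp: bin_def)
      have step: "\<exists>\<zeta>. top_step (z \<^bold>\<or> \<rho>) \<zeta>" using top_step.distr uv by blast
      from mems_pick[OF y] consider "\<sigma> = y" | \<rho>' where "same (y \<^bold>\<and> \<rho>') \<sigma>" by (auto simp: bin_def)
      then show False
      proof cases
        case 1
        then show ?thesis using irr \<rho> step by (auto simp: top_irred_def)
      next
        case (2 \<rho>')
        have "same ((z \<^bold>\<or> \<rho>) \<^bold>\<and> \<rho>') (y \<^bold>\<and> \<rho>')" using same_fill[OF \<rho>, of "CInter2 Hole \<rho>'"] by simp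
        then have "same ((z \<^bold>\<or> \<rho>) \<^bold>\<and> \<rho>') \<sigma>" using 2 by (simp add: same_def)
        then show ?thesis using irr step top_step.inter1 by (meson top_irred_def)
      qed
    qed
  qed
  then show ?thesis using reads_exists[OF y_irr] by blast
qed

abbreviation ty_of_clause :: "el list \<Rightarrow> ty_expr" where
  "ty_of_clause B \<equiv> big False (map ty_of_el B)"

lemma clause_le_imp_norm_le:
  assumes "B \<noteq> []" "\<forall>b\<in>set B. normal b" "\<forall>b\<in>set B'. normal b" "clause_le B B'"
  shows "ty_of_clause B \<preceq> ty_of_clause B'"
proof (rule big_False_le)
  fix y assume "y \<in> set (map ty_of_el B)"
  then obtain b where b: "b \<in> set B" "y = ty_of_el b" by auto
  then obtain b' where b': "b' \<in> set B'" "el_le b b'" using assms(4) by (auto simp: clause_le_def)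
  then have "y \<preceq> ty_of_el b'" using assms b el_le_imp_norm_le by blast
  then show "y \<preceq> ty_of_clause B'"
    using le_big_False[of "ty_of_el b'" "map ty_of_el B'"] b' by (auto intro: le_trans)
qed (use assms in simp)

text \<open>The argument of \<open>reads_exists\<close> one level up: incomparable members have
  incomparable clauses by \<open>clause_le_imp_norm_le\<close>.\<close>

lemma inner_irred_cnf:
  assumes "inner_irred \<sigma>" "\<And>y. y \<in> mems True \<sigma> \<Longrightarrow> \<exists>B. reads False y B"
  shows "cnf \<sigma> \<noteq> [] \<and> antichain clause_le (set (cnf \<sigma>)) \<and>
    (\<forall>B\<in>set (cnf \<sigma>). \<exists>y\<in>mems True \<sigma>. reads False y B) \<and> big True (map ty_of_clause (cnf \<sigma>)) \<approx> \<sigma>"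
  using assms
proof (induction \<sigma> rule: bin_induct[of True])
  case (single \<sigma>)
  then obtain B where "reads False \<sigma> B" by auto
  moreover from this have "cnf \<sigma> = [B]" by (simp add: reads_def)
  ultimately show ?case using single(1) by (auto simp: antichain_def reads_def)
next
  case (bin \<sigma> \<tau>)
  have irr: "inner_irred \<sigma>" "inner_irred \<tau>" using inner_irred_bin[OF bin.prems(1)] by auto
  have IH1: "cnf \<sigma> \<noteq> [] \<and> antichain clause_le (set (cnf \<sigma>)) \<and>
    (\<forall>B\<in>set (cnf \<sigma>). \<exists>y\<in>mems True \<sigma>. reads False y B) \<and> big True (map ty_of_clause (cnf \<sigma>)) \<approx> \<sigma>"
    using bin.prems(2) by (intro bin.IH(1) irr) (simp add: mems_bin)
  have IH2: "cnf \<tau> \<noteq> [] \<and> antichain clause_le (set (cnf \<tau>)) \<and>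
    (\<forall>B\<in>set (cnf \<tau>). \<exists>y\<in>mems True \<tau>. reads False y B) \<and> big True (map ty_of_clause (cnf \<tau>)) \<approx> \<tau>"
    using bin.prems(2) by (intro bin.IH(2) irr) (simp add: mems_bin)
  have cnf: "cnf (bin True \<sigma> \<tau>) = cnf \<sigma> @ cnf \<tau>" by (simp add: bin_def)
  have "antichain clause_le (set (cnf \<sigma>) \<union> set (cnf \<tau>))"
  proof (rule antichain_Un)
    fix B B' assume "B \<in> set (cnf \<sigma>)" "B' \<in> set (cnf \<tau>)"
    then obtain y y' where y: "y \<in> mems True \<sigma>" "y' \<in> mems True \<tau>" "reads False y B" "reads False y' B'"
      using IH1 IH2 by blast
    have r: "B \<noteq> []" "\<forall>b\<in>set B. normal b" "ty_of_clause B \<approx> y"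
      "B' \<noteq> []" "\<forall>b\<in>set B'. normal b" "ty_of_clause B' \<approx> y'"
      using y by (simp_all add: reads_def)
    show "\<not> clause_le B B' \<and> \<not> clause_le B' B"
      using inner_irred_incomparable[OF bin.prems(1) y(1,2)]
        clause_le_imp_norm_le[OF r(1,2,5)] clause_le_imp_norm_le[OF r(4,5,2)] aci_norm_le r(3,6) by blast
  qed (use IH1 IH2 in blast)+
  moreover have "big True (map ty_of_clause (cnf \<sigma> @ cnf \<tau>)) \<approx> bin True \<sigma> \<tau>"
    using IH1 IH2 by (simp add: aci_iff abs_big_append abs_bin)
  ultimately show ?case unfolding cnf using IH1 IH2 by (auto simp: mems_bin)
qed

lemma top_irred_cnf:
  assumes "top_irred \<sigma>"
  shows "antichain clause_le (set (cnf \<sigma>)) \<and> big True (map ty_of_clause (cnf \<sigma>)) \<approx> \<sigma> \<and>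
    (\<forall>B\<in>set (cnf \<sigma>). antichain el_le (set B) \<and> (\<forall>b\<in>set B. normal b))"
proof (cases "\<sigma> = \<omega>")
  case True
  then show ?thesis by (simp add: antichain_def aci.refl)
next
  case False
  then show ?thesis
    using inner_irred_cnf[OF top_irred_inner[OF assms] top_irred_clause[OF assms False]]
    unfolding reads_def by blast
qed

text \<open>Antichain matching is used at two levels, first for clauses and then for the elements of
  matched clauses.\<close>

lemma top_irred_unique:
  assumes \<sigma>: "top_irred \<sigma>" and \<tau>: "top_irred \<tau>" and eq: "cnf_eq \<sigma> \<tau>"
  shows "\<sigma> \<approx> \<tau>"
proof -
  have *: "\<exists>y\<in>set (map ty_of_clause (cnf \<tau>)). x \<approx> y"
    if "top_irred \<sigma>" "top_irred \<tau>" "cnf_eq \<sigma> \<tau>" "x \<in> set (map ty_of_clause (cnf \<sigma>))" for \<sigma> \<tau> x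
  proof -
    from that(4) obtain B where B: "B \<in> set (cnf \<sigma>)" "x = ty_of_clause B" by auto
    \<comment> \<open>The order \<open>cnf_le\<close> provides smaller clauses, hence the downward
      form of the matching.\<close>
    have "\<exists>B'\<in>set (cnf \<tau>). clause_le B B' \<and> clause_le B' B"
      using that(3) B(1) top_irred_cnf[OF that(1)]
      by (intro antichain_match'[OF transp_clause_le, of "set (cnf \<sigma>)"])
        (auto simp: cnf_eq_def cnf_le_def)
    then obtain B' where B': "B' \<in> set (cnf \<tau>)" "clause_le B B'" "clause_le B' B" by blast
    have "ty_of_clause B \<approx> ty_of_clause B'"
      using top_irred_cnf[OF that(1)] top_irred_cnf[OF that(2)] B B'
      by (intro clause_unique el_unique) auto
    then show ?thesis using B B' by auto
  qed
  have "cnf_eq \<tau> \<sigma>" using eq by (simp add: cnf_eq_def)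
  then have "big True (map ty_of_clause (cnf \<sigma>)) \<approx> big True (map ty_of_clause (cnf \<tau>))"
    using *[OF \<sigma> \<tau> eq] *[OF \<tau> \<sigma>] by (intro big_cong) blast+
  then show ?thesis using top_irred_cnf[OF \<sigma>] top_irred_cnf[OF \<tau>] by (simp add: aci_iff)
qed

section \<open>Normal forms and confluence\<close>

lemma cnf_eq_trans: "cnf_eq \<sigma> \<tau> \<Longrightarrow> cnf_eq \<tau> \<rho> \<Longrightarrow> cnf_eq \<sigma> \<rho>"
  unfolding cnf_eq_def by (meson cnf_le_trans)

lemma top_red_cnf_eq:
  assumes "X \<Longrightarrow>\<^sub>t Y" "X = abs_ty \<sigma>" "Y = abs_ty \<tau>"
  shows "cnf_eq \<sigma> \<tau>"
proof -
  obtain \<sigma>' \<tau>' where "abs_ty \<sigma> = abs_ty \<sigma>'" "abs_ty \<tau>' = abs_ty \<tau>" "top_step \<sigma>' \<tau>'"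
    using assms unfolding top_red_def by metis
  then show ?thesis using aci_cnf_eq top_step_cnf_eq cnf_eq_trans by (meson aci_iff)
qed

lemma abs_ty_surj: "\<exists>\<sigma>. X = abs_ty \<sigma>"
  by (induction X rule: ty.abs_induct) blast

lemma top_reds_cnf_eq:
  assumes "(\<Longrightarrow>\<^sub>t)\<^sup>*\<^sup>* X Y" "X = abs_ty \<sigma>" "Y = abs_ty \<tau>"
  shows "cnf_eq \<sigma> \<tau>"
  using assms
proof (induction arbitrary: \<tau> rule: rtranclp_induct)
  case base
  then show ?case by (intro aci_cnf_eq) (simp add: aci_iff)
next
  case (step Y Z)
  obtain \<rho> where \<rho>: "Y = abs_ty \<rho>" using abs_ty_surj by blast
  then show ?case using step top_red_cnf_eq cnf_eq_trans by blast
qed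

lemma irredundant_exists: "\<exists>\<sigma>. X = abs_ty \<sigma> \<and> irredundant \<sigma>"
proof -
  obtain \<sigma> where "X = abs_ty \<sigma>" using abs_ty_surj by blast
  then obtain \<tau> where "X = abs_ty \<tau>" "\<And>\<rho>. X = abs_ty \<rho> \<Longrightarrow> size \<tau> \<le> size \<rho>"
    using exists_least_iff[of "\<lambda>n. \<exists>\<tau>. X = abs_ty \<tau> \<and> size \<tau> = n"] by (metis not_le)
  then show ?thesis by (auto simp: irredundant_def aci_iff)
qed

lemma normal_form_exists: "\<exists>Y \<tau>. (\<Longrightarrow>\<^sub>t)\<^sup>*\<^sup>* X Y \<and> Y = abs_ty \<tau> \<and> top_irred \<tau>"
proof (induction X rule: wfp_induct_rule[OF wfp_top_red])
  case (1 X)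
  show ?case
  proof (cases "\<exists>Y. X \<Longrightarrow>\<^sub>t Y")
    case True
    then show ?thesis using 1 by (meson converse_rtranclp_into_rtranclp)
  next
    case False
    obtain \<sigma> where \<sigma>: "X = abs_ty \<sigma>" "irredundant \<sigma>" using irredundant_exists by blast
    \<comment> \<open>Such a \<open>\<rho>\<close> is irredundant as well, so a step from it would
      be a step from \<open>X\<close>.\<close>
    have "\<not> top_step \<rho> \<rho>'" if "same \<rho> \<sigma>" for \<rho> \<rho>'
      using False that \<sigma> unfolding top_red_def same_def irredundant_def aci_iff by metis
    then have "top_irred \<sigma>" using \<sigma> by (simp add: top_irred_def)
    then show ?thesis using \<sigma> by blast
  qed
qed

text \<open>Normal forms of both reducts have clauses equivalent to those of \<open>X\<close>, so
  \<open>top_irred_unique\<close> identifies them.\<close>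

lemma confluentp_top_red: "confluentp (\<Longrightarrow>\<^sub>t)"
proof (rule confluentpI)
  fix X Y Z assume XY: "(\<Longrightarrow>\<^sub>t)\<^sup>*\<^sup>* X Y" and XZ: "(\<Longrightarrow>\<^sub>t)\<^sup>*\<^sup>* X Z"
  obtain Y' \<tau> where Y': "(\<Longrightarrow>\<^sub>t)\<^sup>*\<^sup>* Y Y'" "Y' = abs_ty \<tau>" "top_irred \<tau>"
    using normal_form_exists by blast
  obtain Z' \<rho> where Z': "(\<Longrightarrow>\<^sub>t)\<^sup>*\<^sup>* Z Z'" "Z' = abs_ty \<rho>" "top_irred \<rho>"
    using normal_form_exists by blast
  obtain \<sigma> where \<sigma>: "X = abs_ty \<sigma>" using abs_ty_surj by blast
  have "cnf_eq \<sigma> \<tau>" "cnf_eq \<sigma> \<rho>"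
    using XY XZ Y' Z' \<sigma> by (meson rtranclp_trans top_reds_cnf_eq)+
  then have "cnf_eq \<tau> \<rho>" unfolding cnf_eq_def by (meson cnf_le_trans)
  then have "Y' = Z'" using top_irred_unique Y' Z' by (simp add: aci_iff)
  then show "\<exists>U. (\<Longrightarrow>\<^sub>t)\<^sup>*\<^sup>* Y U \<and> (\<Longrightarrow>\<^sub>t)\<^sup>*\<^sup>* Z U" using Y' Z' by blast
qed

theorem theorem4p3:
  shows "terminating (\<Longrightarrow>\<^sub>t) \<and> confluentp (\<Longrightarrow>\<^sub>t)"
  using terminating_top_red confluentp_top_red ..

end
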